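(* Let $\mathcal{Z}=\{\boldsymbol\zeta_1,\dots,\boldsymbol\zeta_p\}\subseteq\boldsymbol\theta(\mathbb{D}^d)$ be a set of $p$ distinct points and let $w_1,\dots,w_p\in\mathbb{D}$. Then there exists $\varphi\in\mathcal{S}(\boldsymbol\theta(\mathbb{D}^d))$ such that $\varphi(\boldsymbol\zeta_i)=w_i$ for all $i=1,\dots,p$ if and only if there exists a sequence $\{f_n\}\subseteq\mathcal{I}(\boldsymbol\theta(\mathbb{D}^d))$ satisfying $$\lim_{n\to\infty}f_n(\boldsymbol\zeta_j)=w_j,\qquad j=1,\dots,p.$$
   Context: $m,n$ are positive integers with $n\mid m$, $\alpha$ is a primitive $m$-th root of unity, and $G=G(m,n,d)$ is the group of maps $\mathbb{C}^d\ni(z_1,\dots,z_d)\mapsto(\alpha^{k_1}z_{\tau(1)},\dots,\alpha^{k_d}z_{\tau(d)})$, where $\tau$ is a permutation of $\{1,\dots,d\}$ and $k_1,\dots,k_d$ are integers with $n\mid k_1+\cdots+k_d$. $\boldsymbol\theta=(\theta_1,\dots,\theta_d):\mathbb{D}^d\to\boldsymbol\theta(\mathbb{D}^d)$ is the associated basic polynomial map: for $1\le j\le d-1$, $\theta_j$ is the $j$-th elementary symmetric polynomial in $z_1^m,\dots,z_d^m$, and $\theta_d(z)=(z_1\cdots z_d)^{m/n}$. It is a proper holomorphic map onto the bounded domain $\boldsymbol\theta(\mathbb{D}^d)$, and its fibres are the $G$-orbits. $H^\infty(\boldsymbol\theta(\mathbb{D}^d))$ is the algebra of bounded holomorphic functions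 on $\boldsymbol\theta(\mathbb{D}^d)$ with the supremum norm and $\mathcal{S}(\boldsymbol\theta(\mathbb{D}^d))$ (Schur functions) is its closed unit ball. $\mathcal{I}(\boldsymbol\theta(\mathbb{D}^d))=\{f\in H^\infty(\boldsymbol\theta(\mathbb{D}^d)):f\circ\boldsymbol\theta\text{ is an inner function on }\mathbb{D}^d\}$, where an inner function on $\mathbb{D}^d$ is a bounded holomorphic function whose radial boundary values are unimodular a.e. on $\mathbb{T}^d$. $\mathbb{D}$ is the open unit disc and $\mathbb{T}$ the unit circle. *)

theory Defs
  imports "HOL-Analysis.Analysis"
begin

definition polydisc :: "(complex^'d) set" where
  "polydisc = {z. \<forall>i. z $ i \<in> ball 0 1}"

definition elem_sym :: "nat \<Rightarrow> ('d::finite \<Rightarrow> complex) \<Rightarrow> complex" where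
  "elem_sym j x = (\<Sum>A | card A = j. \<Prod>i\<in>A. x i)"

text \<open>The coordinates of \<open>complex^'d\<close> are listed in the order of the index type;
  \<open>coord_rank i\<close> is the position of \<open>i\<close>, so the ranks run through 1, ..., \<open>CARD('d)\<close>.\<close>

definition coord_rank :: "'d::{finite,linorder} \<Rightarrow> nat" where
  "coord_rank i = card {k. k \<le> i}"

text \<open>The basic polynomial map of the reflection group \<open>G(m,n,d)\<close>, with \<open>d = CARD('d)\<close>.\<close>

definition basic_map :: "nat \<Rightarrow> nat \<Rightarrow> complex^('d::{finite,linorder}) \<Rightarrow> complex^('d::{finite,linorder})" where
  "basic_map m n z =
     (\<chi> i. if coord_rank i < CARD('d) then elem_sym (coord_rank i) (\<lambda>k. (z $ k) ^ m)
           else (\<Prod>k\<in>UNIV. z $ k) ^ (m div n))"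

text \<open>Holomorphy in several variables: Frechet differentiability with complex-linear derivative
  (\<open>has_derivative\<close> only provides real linearity). As for \<open>holomorphic_on\<close>, derivatives are
  taken within the set, which makes no difference on the open sets considered here.\<close>

definition mv_holomorphic_on :: "(complex^'d \<Rightarrow> complex) \<Rightarrow> (complex^'d) set \<Rightarrow> bool" where
  "mv_holomorphic_on f S \<longleftrightarrow>
     (\<forall>z\<in>S. \<exists>L. (f has_derivative L) (at z within S) \<and> (\<forall>c v. L (c *s v) = c * L v))"

definition Hinf :: "(complex^'d) set \<Rightarrow> (complex^'d \<Rightarrow> complex) set" where
  "Hinf S = {f. mv_holomorphic_on f S \<and> bounded (f ` S)}"

definition sup_norm :: "(complex^'d) set \<Rightarrow> (complex^'d \<Rightarrow> complex) \<Rightarrow> real" where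
  "sup_norm S f = (SUP z\<in>S. cmod (f z))"

definition Schur :: "(complex^'d) set \<Rightarrow> (complex^'d \<Rightarrow> complex) set" where
  "Schur S = {f \<in> Hinf S. sup_norm S f \<le> 1}"

text \<open>Normalized Lebesgue (Haar) measure on the distinguished boundary of the polydisc (the torus), as a Borel measure
  on \<open>complex^'d\<close>.\<close>

definition torus_measure :: "(complex^'d::finite) measure" where
  "torus_measure =
     distr (uniform_measure lborel (cbox 0 (\<chi> i. 2 * pi))) borel
           (\<lambda>t::real^'d. \<chi> i. cis (t $ i))"

lemma measurable_torus_param:
  "(\<lambda>t::real^'d::finite. \<chi> i. cis (t $ i)) \<in> borel_measurable borel"
  by (intro borel_measurable_continuous_onI continuous_intros)

definition inner_function :: "(complex^'d::finite \<Rightarrow> complex) \<Rightarrow> bool" where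
  "inner_function f \<longleftrightarrow>
     f \<in> Hinf polydisc \<and>
     (AE \<zeta> in torus_measure. \<exists>l. ((\<lambda>r::real. f (r *\<^sub>R \<zeta>)) \<longlongrightarrow> l) (at_left 1) \<and> cmod l = 1)"

definition inner_on_image :: "nat \<Rightarrow> nat \<Rightarrow> (complex^('d::{finite,linorder}) \<Rightarrow> complex) set" where
  "inner_on_image m n =
     {f \<in> Hinf (basic_map m n ` polydisc). inner_function (f \<circ> basic_map m n)}"

end

(*
  Write Omega for the image of the polydisc under theta, and d_s for the weighted dilation with
  theta(s z) = d_s(theta z).

  A Schur function phi splits into components homogeneous with respect to d_s, the Taylor
  coefficients of s |-> phi(d_s w). On Omega they are bounded by 1, and they extend to entire
  functions of polynomial growth, so they are polynomials in w. Thus phi is a pointwise limit on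
  Omega of polynomials p with |p| < 1. Since complex conjugation on the torus maps theta_j to
  theta_(d-j) up to a power of theta_d, Rudin's functions (p + theta_d^N) / (1 + theta_d^N p~), with
  p~ the conjugate polynomial, are again functions of theta; they are inner and converge to p.

  Conversely, inner functions are bounded by 1, so a sequence in I(Omega) is a normal family and any
  cluster point interpolates. Omega is open because theta is a proper surjection of C^d under which
  the polydisc is saturated.
*)
theory Submission
  imports Defs "HOL-Complex_Analysis.Complex_Analysis" "HOL-Computational_Algebra.Computational_Algebra"
    "HOL-Real_Asymp.Real_Asymp"
begin

text \<open>Expanding \<phi> on Omega itself, rather than \<phi> o theta on the polydisc, makes the
  components functions of w = theta(z) from the start, so being a polynomial becomes a question of
  growth. Omega is a neighbourhood of 0 and all weights are positive, hence every w is carried into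
  Omega by dilations with parameter up to a multiple of 1 / (1 + |w|), and Cauchy's estimates give
  growth of order k for the k-th component. The polynomials must stay below some \<rho> < 1: the
  reflected polynomial inherits this bound from the torus by the maximum principle, so Rudin's
  denominator has modulus at least 1 - \<rho> on the closed polydisc. The power of theta_d both
  absorbs the powers created by conjugation and, since |theta_d| < 1 inside, makes the correction
  vanish in the limit. In the converse, an inner function is controlled only through radial limits
  at almost every point of the torus, so bounding it by 1 has to pass through an integral over the
  torus.\<close>

no_notation fps_nth (infixl "$" 75)

section \<open>Holomorphic and polynomial functions of several variables\<close>

text \<open>The gateway to one-variable complex analysis: along a curve with holomorphic coordinates
  a complex-linear derivative becomes multiplication by the number \<open>L D\<close>. It is applied
  to complex lines, coordinate slices and orbits of the weighted dilations.\<close>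

lemma mv_holomorphic_on_compose_curve:
  fixes f :: "complex^'d \<Rightarrow> complex"
  assumes f: "mv_holomorphic_on f S" and U: "open U"
    and g: "\<And>i. (\<lambda>x. g x $ i) holomorphic_on U" and gU: "\<And>x. x \<in> U \<Longrightarrow> g x \<in> S"
  shows "(\<lambda>x. f (g x)) holomorphic_on U"
proof -
  have "(\<lambda>x. f (g x)) field_differentiable (at x within U)" if x: "x \<in> U" for x
  proof -
    obtain L where L: "(f has_derivative L) (at (g x) within S)" "\<And>c v. L (c *s v) = c * L v"
      using f gU[OF x] unfolding mv_holomorphic_on_def by blast
    define D where "D = (\<chi> i. deriv (\<lambda>x. g x $ i) x)"
    have "((\<lambda>x. g x $ i) has_derivative (\<lambda>h. (h *s D) $ i)) (at x within U)" for i
    proof -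
      have "((\<lambda>x. g x $ i) has_field_derivative D $ i) (at x within U)"
        using holomorphic_derivI[OF g U x, of i] by (simp add: D_def)
      then show ?thesis
        by (simp add: has_field_derivative_def mult.commute[of _ "D $ i"])
    qed
    then have "(g has_derivative (\<lambda>h. h *s D)) (at x within U)"
      unfolding has_derivative_componentwise_within[of g]
      by (auto simp: Basis_vec_def cart_eq_inner_axis[symmetric] inner_axis intro!: has_derivative_inner_left)
    moreover have "(f has_derivative L) (at (g x) within g ` U)"
      using L(1) gU by (auto intro: has_derivative_subset)
    ultimately have "((\<lambda>x. f (g x)) has_derivative (\<lambda>h. L (h *s D))) (at x within U)"
      by (rule has_derivative_in_compose)
    then have "((\<lambda>x. f (g x)) has_field_derivative L D) (at x within U)"
      unfolding L(2) has_field_derivative_def by (simp add: mult.commute[of _ "L D"])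
    then show ?thesis by (auto simp: field_differentiable_def)
  qed
  then show ?thesis by (simp add: holomorphic_on_def)
qed

definition vec_upd :: "'a^'d \<Rightarrow> 'd \<Rightarrow> 'a \<Rightarrow> 'a^'d" where
  "vec_upd z i x = (\<chi> k. if k = i then x else z $ k)"

lemma vec_upd_nth [simp]: "vec_upd z i x $ k = (if k = i then x else z $ k)"
  by (simp add: vec_upd_def)

lemma vec_upd_same [simp]: "vec_upd z i (z $ i) = z"
  by (simp add: vec_eq_iff)

lemma mv_holomorphic_on_imp_continuous_on:
  "mv_holomorphic_on f S \<Longrightarrow> continuous_on S f"
  unfolding mv_holomorphic_on_def continuous_on_eq_continuous_within
  using has_derivative_continuous by blast

text \<open>Generated by sums and products rather than by monomials with coefficients, since
  composition, differentiability and reflection in the torus are all obtained by rule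
  induction.\<close>

inductive poly_fun :: "(complex^'d \<Rightarrow> complex) \<Rightarrow> bool" where
  poly_fun_const: "poly_fun (\<lambda>z. c)"
| poly_fun_nth: "poly_fun (\<lambda>z. z $ i)"
| poly_fun_add: "poly_fun p \<Longrightarrow> poly_fun q \<Longrightarrow> poly_fun (\<lambda>z. p z + q z)"
| poly_fun_mult: "poly_fun p \<Longrightarrow> poly_fun q \<Longrightarrow> poly_fun (\<lambda>z. p z * q z)"

named_theorems poly_fun_intros
declare poly_fun.intros [poly_fun_intros]

lemma poly_fun_sum [poly_fun_intros]:
  "(\<And>a. a \<in> A \<Longrightarrow> poly_fun (f a)) \<Longrightarrow> poly_fun (\<lambda>z. \<Sum>a\<in>A. f a z)"
  by (induction A rule: infinite_finite_induct) (auto intro: poly_fun.intros)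

lemma poly_fun_prod [poly_fun_intros]:
  "(\<And>a. a \<in> A \<Longrightarrow> poly_fun (f a)) \<Longrightarrow> poly_fun (\<lambda>z. \<Prod>a\<in>A. f a z)"
  by (induction A rule: infinite_finite_induct) (auto intro: poly_fun.intros)

lemma poly_fun_power [poly_fun_intros]: "poly_fun f \<Longrightarrow> poly_fun (\<lambda>z. f z ^ k)"
  by (induction k) (auto intro: poly_fun.intros)

lemma poly_fun_diff [poly_fun_intros]:
  assumes "poly_fun f" "poly_fun g" shows "poly_fun (\<lambda>z. f z - g z)"
  using poly_fun_add[OF assms(1) poly_fun_mult[OF poly_fun_const[of "-1"] assms(2)]] by simp

lemma poly_fun_compose:
  "poly_fun p \<Longrightarrow> (\<And>i. poly_fun (\<lambda>z. g z $ i)) \<Longrightarrow> poly_fun (\<lambda>z. p (g z))"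
  by (induction rule: poly_fun.induct) (auto intro: poly_fun.intros)

lemma poly_fun_holomorphic_curve:
  "poly_fun p \<Longrightarrow> (\<And>i. (\<lambda>x. g x $ i) holomorphic_on U) \<Longrightarrow> (\<lambda>x. p (g x)) holomorphic_on U"
  by (induction rule: poly_fun.induct) (auto intro!: holomorphic_intros)

lemma poly_fun_continuous: "poly_fun p \<Longrightarrow> continuous_on S p"
  by (induction rule: poly_fun.induct) (auto intro!: continuous_intros)

lemma mv_holomorphic_on_poly_fun: "poly_fun p \<Longrightarrow> mv_holomorphic_on p S"
proof (induction rule: poly_fun.induct)
  case (poly_fun_const c)
  then show ?case unfolding mv_holomorphic_on_def
    by (auto intro!: exI[of _ "\<lambda>_. 0"])
next
  case (poly_fun_nth i)
  then show ?case unfolding mv_holomorphic_on_def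
    by (auto intro!: exI[of _ "\<lambda>z. z $ i"] bounded_linear_imp_has_derivative bounded_linear_vec_nth)
next
  case (poly_fun_add p q)
  show ?case unfolding mv_holomorphic_on_def
  proof
    fix z assume z: "z \<in> S"
    obtain L M where "(p has_derivative L) (at z within S)" "\<And>c v. L (c *s v) = c * L v"
      "(q has_derivative M) (at z within S)" "\<And>c v. M (c *s v) = c * M v"
      using poly_fun_add.IH z unfolding mv_holomorphic_on_def by meson
    then show "\<exists>L. ((\<lambda>z. p z + q z) has_derivative L) (at z within S) \<and> (\<forall>c v. L (c *s v) = c * L v)"
      by (intro exI[of _ "\<lambda>v. L v + M v"]) (auto intro!: derivative_intros simp: algebra_simps)
  qed
next
  case (poly_fun_mult p q)
  show ?case unfolding mv_holomorphic_on_def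
  proof
    fix z assume z: "z \<in> S"
    obtain L M where "(p has_derivative L) (at z within S)" "\<And>c v. L (c *s v) = c * L v"
      "(q has_derivative M) (at z within S)" "\<And>c v. M (c *s v) = c * M v"
      using poly_fun_mult.IH z unfolding mv_holomorphic_on_def by meson
    moreover from this have "((\<lambda>z. p z * q z) has_derivative (\<lambda>v. p z * M v + L v * q z)) (at z within S)"
      by (intro has_derivative_mult)
    ultimately show "\<exists>L. ((\<lambda>z. p z * q z) has_derivative L) (at z within S) \<and> (\<forall>c v. L (c *s v) = c * L v)"
      by (intro exI[of _ "\<lambda>v. p z * M v + L v * q z"]) (auto simp: distrib_left)
  qed
qed

lemma mv_holomorphic_on_divide:
  fixes p q :: "complex^'d \<Rightarrow> complex"
  assumes "mv_holomorphic_on p S" "mv_holomorphic_on q S" and nz: "\<And>z. z \<in> S \<Longrightarrow> q z \<noteq> 0"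
  shows "mv_holomorphic_on (\<lambda>z. p z / q z) S"
  unfolding mv_holomorphic_on_def
proof
  fix z assume z: "z \<in> S"
  obtain L M where "(p has_derivative L) (at z within S)" "\<And>c v. L (c *s v) = c * L v"
    "(q has_derivative M) (at z within S)" "\<And>c v. M (c *s v) = c * M v"
    using assms(1,2) z unfolding mv_holomorphic_on_def by meson
  moreover from this nz[OF z]
  have "((\<lambda>z. p z / q z) has_derivative (\<lambda>v. (L v * q z - p z * M v) / (q z * q z))) (at z within S)"
    by (intro has_derivative_divide') auto
  ultimately show "\<exists>L. ((\<lambda>z. p z / q z) has_derivative L) (at z within S) \<and> (\<forall>c v. L (c *s v) = c * L v)"
    by (intro exI[of _ "\<lambda>v. (L v * q z - p z * M v) / (q z * q z)"])
      (auto simp: algebra_simps diff_divide_distrib)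
qed

section \<open>The basic polynomial map\<close>

text \<open>Vieta's formulas: expanding the product selects the set of factors that contribute
  \<open>- x i\<close>, and these sets are grouped by cardinality.\<close>

lemma linear_factors_expand:
  fixes x :: "'d::finite \<Rightarrow> complex"
  shows "(\<Prod>i\<in>UNIV. t - x i) = (\<Sum>j\<le>CARD('d). (-1)^j * elem_sym j x * t ^ (CARD('d) - j))"
proof -
  have "(\<Prod>i\<in>UNIV. t - x i) = (\<Prod>i\<in>UNIV. - x i + t)" by simp
  also have "\<dots> = (\<Sum>A\<in>Pow UNIV. (\<Prod>i\<in>A. - x i) * (\<Prod>i\<in>UNIV - A. t))"
    by (rule prod_add) simp
  also have "\<dots> = (\<Sum>A\<in>UNIV. (-1) ^ card A * (\<Prod>i\<in>A. x i) * t ^ (CARD('d) - card A))"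
    by (intro sum.cong) (auto simp: prod_uminus card_Diff_subset)
  also have "\<dots> = (\<Sum>j\<le>CARD('d). \<Sum>A | A \<in> UNIV \<and> card A = j. (-1) ^ card A * (\<Prod>i\<in>A. x i) * t ^ (CARD('d) - card A))"
    by (rule sum.group[symmetric]) (auto intro: card_mono)
  also have "\<dots> = (\<Sum>j\<le>CARD('d). (-1)^j * elem_sym j x * t ^ (CARD('d) - j))"
    unfolding elem_sym_def sum_distrib_left sum_distrib_right by (intro sum.cong) auto
  finally show ?thesis .
qed

lemma elem_sym_0 [simp]: "elem_sym 0 x = 1"
proof -
  have "{A :: 'a set. card A = 0} = {{}}" by auto
  then show ?thesis by (simp add: elem_sym_def)
qed

lemma elem_sym_card: "elem_sym CARD('d) (x :: 'd::finite \<Rightarrow> complex) = prod x UNIV"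
proof -
  have "{A :: 'd set. card A = CARD('d)} = {UNIV}"
    using card_eq_UNIV_imp_eq_UNIV[where 'a='d] by auto
  then show ?thesis by (simp add: elem_sym_def)
qed

text \<open>The full product turns a product of reciprocals over a set into the product over its
  complement. On the torus reciprocals are conjugates, which is where this is applied.\<close>

lemma elem_sym_inverse:
  fixes x :: "'d::finite \<Rightarrow> complex"
  assumes "\<And>i. x i \<noteq> 0" "j \<le> CARD('d)"
  shows "elem_sym j (\<lambda>i. inverse (x i)) * prod x UNIV = elem_sym (CARD('d) - j) x"
proof -
  have "elem_sym j (\<lambda>i. inverse (x i)) * prod x UNIV = (\<Sum>A | card A = j. prod x (- A))"
    unfolding elem_sym_def sum_distrib_right
  proof (intro sum.cong refl)
    fix A :: "'d set"
    have "prod x UNIV = prod x A * prod x (- A)"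
      by (metis Compl_eq_Diff_UNIV finite mult.commute prod.subset_diff top_greatest)
    moreover have "prod x A \<noteq> 0" using assms(1) by simp
    ultimately show "(\<Prod>i\<in>A. inverse (x i)) * prod x UNIV = prod x (- A)"
      using prod_inversef[of x A] by (simp add: o_def)
  qed
  also have "\<dots> = elem_sym (CARD('d) - j) x"
    unfolding elem_sym_def
    by (rule sum.reindex_bij_witness[where i=uminus and j=uminus]) (use assms(2) in \<open>auto simp: Compl_eq_Diff_UNIV card_Diff_subset\<close>)
  finally show ?thesis .
qed

text \<open>By the fundamental theorem of algebra, the roots of the monic polynomial with
  coefficients \<open>(-1)^j * c j\<close> are the required \<open>x\<close>; comparing coefficients
  with Vieta's formulas finishes.\<close>

lemma exists_elem_sym_eq:
  fixes c :: "nat \<Rightarrow> complex"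
  obtains x :: "'d::finite \<Rightarrow> complex" where "\<And>j. 1 \<le> j \<Longrightarrow> j \<le> CARD('d) \<Longrightarrow> elem_sym j x = c j"
proof -
  define d where "d = CARD('d)"
  \<comment> \<open>The value at 0 is overwritten so that \<open>P\<close> is monic, whatever
    \<open>c 0\<close> is.\<close>
  define c' where "c' j = (if j = 0 then 1 else c j)" for j
  define P :: "complex poly" where "P = (\<Sum>j\<le>d. monom ((-1)^j * c' j) (d - j))"
  have coeff: "coeff P (d - j) = (-1)^j * c' j" if "j \<le> d" for j
  proof -
    have "coeff P (d - j) = (\<Sum>i\<le>d. if i = j then (-1)^i * c' i else 0)"
      unfolding P_def coeff_sum coeff_monom by (intro sum.cong) (use that in auto)
    also have "\<dots> = (-1)^j * c' j" using that by simp
    finally show ?thesis .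
  qed
  have "degree P \<le> d" unfolding P_def
    by (rule degree_sum_le) (auto intro: order.trans[OF degree_monom_le])
  moreover have "coeff P d = 1" using coeff[of 0] by (simp add: c'_def)
  ultimately have deg: "degree P = d" using le_degree[of P d] by simp
  obtain root where "smult (lead_coeff P) (\<Prod>i<degree P. [:-root i, 1:]) = P"
    using complex_poly_decompose'[of P] by blast
  then have root: "P = (\<Prod>i<d. [:-root i, 1:])"
    unfolding deg \<open>coeff P d = 1\<close> smult_1_left by (rule sym)
  obtain b :: "'d \<Rightarrow> nat" where b: "bij_betw b UNIV {..<d}"
    using ex_bij_betw_finite_nat[OF finite[of "UNIV :: 'd set"]] unfolding d_def atLeast0LessThan by blast
  define x where "x i = root (b i)" for i
  define Q :: "complex poly" where "Q = (\<Sum>j\<le>d. monom ((-1)^j * elem_sym j x) (d - j))"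
  have Qcoeff: "coeff Q (d - j) = (-1)^j * elem_sym j x" if "j \<le> d" for j
  proof -
    have "coeff Q (d - j) = (\<Sum>i\<le>d. if i = j then (-1)^i * elem_sym i x else 0)"
      unfolding Q_def coeff_sum coeff_monom by (intro sum.cong) (use that in auto)
    also have "\<dots> = (-1)^j * elem_sym j x" using that by simp
    finally show ?thesis .
  qed
  have "poly P t = poly Q t" for t
  proof -
    have "poly P t = (\<Prod>i<d. t - root i)" by (simp add: root poly_prod)
    also have "\<dots> = (\<Prod>i\<in>UNIV. t - x i)"
      unfolding x_def using prod.reindex_bij_betw[OF b, of "\<lambda>i. t - root i"] by simp
    also have "\<dots> = poly Q t"
      by (simp add: linear_factors_expand Q_def poly_sum poly_monom d_def)
    finally show ?thesis .
  qed
  then have "P = Q" by (simp add: poly_eq_poly_eq_iff[symmetric] fun_eq_iff)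
  with coeff Qcoeff have "(-1)^j * elem_sym j x = (-1)^j * c' j" if "j \<le> d" for j
    using that by simp
  then have "elem_sym j x = c' j" if "j \<le> d" for j using that by simp
  with that[of x] show thesis by (auto simp: c'_def d_def)
qed

section \<open>Numbering of the coordinates and Vieta coefficients of a point in the image\<close>

lemma coord_rank_bij: "bij_betw (coord_rank :: 'd::{finite,linorder} \<Rightarrow> nat) UNIV {1..CARD('d)}"
proof -
  have mono: "coord_rank i < coord_rank j" if "i < j" for i j :: 'd
    unfolding coord_rank_def
  proof (rule psubset_card_mono)
    have "j \<in> {k. k \<le> j}" "j \<notin> {k. k \<le> i}" using that by auto
    moreover have "{k. k \<le> i} \<subseteq> {k. k \<le> j}" using that by auto
    ultimately show "{k. k \<le> i} \<subset> {k. k \<le> j}" by blast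
  qed simp
  have "inj (coord_rank :: 'd \<Rightarrow> nat)"
    by (metis injI mono linorder_neqE nat_neq_iff)
  moreover have "range (coord_rank :: 'd \<Rightarrow> nat) \<subseteq> {1..CARD('d)}"
    using card_mono[OF finite subset_UNIV] order_refl
    by (fastforce simp: coord_rank_def Suc_le_eq card_gt_0_iff)
  moreover have "card (range (coord_rank :: 'd \<Rightarrow> nat)) = CARD('d)"
    using calculation(1) by (simp add: card_image)
  ultimately show ?thesis
    by (metis bij_betw_def card_atLeastAtMost card_subset_eq diff_Suc_1 finite_atLeastAtMost)
qed

lemma coord_rank_obtain:
  assumes "1 \<le> j" "j \<le> CARD('d)"
  obtains i :: "'d::{finite,linorder}" where "coord_rank i = j"
proof -
  have "j \<in> coord_rank ` (UNIV :: 'd set)"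
    using coord_rank_bij[where 'd='d] assms by (auto simp: bij_betw_def)
  then show thesis using that by auto
qed

lemma coord_rank_bounds: "1 \<le> coord_rank i" "coord_rank (i :: 'd::{finite,linorder}) \<le> CARD('d)"
  using coord_rank_bij[where 'd='d] by (auto simp: bij_betw_def)

lemma coord_rank_inj: "coord_rank i = coord_rank j \<longleftrightarrow> i = (j :: 'd::{finite,linorder})"
  using coord_rank_bij[where 'd='d] by (auto simp: bij_betw_def inj_def)

definition last_idx :: "'d::{finite,linorder}" where "last_idx = (SOME i. coord_rank i = CARD('d))"

lemma coord_rank_last: "coord_rank (last_idx :: 'd::{finite,linorder}) = CARD('d)"
proof -
  obtain i :: 'd where "coord_rank i = CARD('d)"
    by (rule coord_rank_obtain[of "CARD('d)"]) (auto simp: Suc_le_eq)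
  then show ?thesis unfolding last_idx_def by (rule someI)
qed

lemma coord_rank_less_iff: "coord_rank i < CARD('d) \<longleftrightarrow> i \<noteq> (last_idx :: 'd::{finite,linorder})"
  by (metis coord_rank_bounds(2) coord_rank_inj coord_rank_last le_neq_implies_less less_irrefl)

lemma basic_map_nth:
  "basic_map m n z $ (i::'d::{finite,linorder}) = (if i \<noteq> last_idx then elem_sym (coord_rank i) (\<lambda>k. z $ k ^ m)
     else (\<Prod>k\<in>UNIV. z $ k) ^ (m div n))"
  by (simp add: basic_map_def coord_rank_less_iff)

text \<open>Supplies the one Vieta coefficient of the z_k^m that is not itself a coordinate of the
  basic map.\<close>

lemma basic_map_last_power:
  assumes "n dvd m"
  shows "(basic_map m n z $ (last_idx :: 'd::{finite,linorder})) ^ n = elem_sym CARD('d) (\<lambda>k. z $ k ^ m)"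
  using assms by (simp add: basic_map_nth elem_sym_card prod_power_distrib power_mult[symmetric])

text \<open>The coefficients of \<open>\<Prod>k (t - z\<^sub>k ^ m)\<close> up to sign, read off from \<open>basic_map m n z\<close>.\<close>

definition sym_coeff :: "nat \<Rightarrow> complex^('d::{finite,linorder}) \<Rightarrow> nat \<Rightarrow> complex" where
  "sym_coeff n w j = (if j = 0 then 1 else if j = CARD('d) then (w $ last_idx) ^ n
     else w $ (SOME i. coord_rank i = j))"

lemma sym_coeff_basic_map:
  fixes z :: "complex^('d::{finite,linorder})"
  assumes "n dvd m" "j \<le> CARD('d)"
  shows "sym_coeff n (basic_map m n z) j = elem_sym j (\<lambda>k. z $ k ^ m)"
proof (cases "j = 0 \<or> j = CARD('d)")
  case True
  then show ?thesis using basic_map_last_power[OF assms(1), of z] by (auto simp: sym_coeff_def)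
next
  case False
  define i :: 'd where "i = (SOME i. coord_rank i = j)"
  have "coord_rank i = j" unfolding i_def 
    by (rule someI_ex) (metis False Suc_leI assms(2) bot_nat_0.not_eq_extremum One_nat_def coord_rank_obtain)
  with False show ?thesis
    using coord_rank_less_iff[of i] assms(2) by (simp add: sym_coeff_def i_def[symmetric] basic_map_nth)
qed

text \<open>The polynomial with roots z_k^m is determined by the image point. This yields both that
  fibres preserve the set of coordinate moduli and that the map is proper.\<close>

lemma basic_map_factors:
  fixes z :: "complex^('d::{finite,linorder})"
  assumes "n dvd m"
  shows "(\<Prod>i\<in>UNIV. t - z $ i ^ m) =
    (\<Sum>j\<le>CARD('d). (-1)^j * sym_coeff n (basic_map m n z) j * t ^ (CARD('d) - j))"
  unfolding linear_factors_expand by (intro sum.cong) (auto simp: sym_coeff_basic_map[OF assms])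

text \<open>Taking Vieta roots and then m-th roots \<open>y\<close> gets all coordinates right
  except the last, of which only the n-th power was prescribed. Rotating a single coordinate by an
  m-th root of unity repairs it without changing the z_k^m.\<close>

lemma basic_map_surj:
  fixes w :: "complex^('d::{finite,linorder})"
  assumes "m > 0" "n > 0" "n dvd m"
  obtains z where "basic_map m n z = w"
proof -
  obtain x :: "'d \<Rightarrow> complex" where x: "\<And>j. 1 \<le> j \<Longrightarrow> j \<le> CARD('d) \<Longrightarrow> elem_sym j x = sym_coeff n w j"
    using exists_elem_sym_eq[of "sym_coeff n w"] by blast
  have "\<exists>y. y ^ m = x i" for i
    using exists_complex_root[of m "x i"] assms(1) by (metis neq0_conv)
  then obtain y where y: "\<And>i. y i ^ m = x i" by metis
  define l :: 'd where "l = last_idx"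
  define u where "u = (\<Prod>k\<in>UNIV. y k) ^ (m div n)"
  have "u ^ n = (\<Prod>k\<in>UNIV. x k)"
    using assms(3) by (simp add: u_def power_mult[symmetric] prod_power_distrib y)
  also have "\<dots> = (w $ l) ^ n"
    using x[of "CARD('d)"] by (simp add: elem_sym_card sym_coeff_def l_def Suc_leI)
  finally have un: "u ^ n = (w $ l) ^ n" .
  \<comment> \<open>If \<open>u = 0\<close>, the last coordinate of \<open>w\<close> is 0 too and
    \<open>1\<close> serves. Otherwise the quotient \<open>w $ l / u\<close> has n-th power 1, so
    each of its \<open>m div n\<close>-th roots satisfies \<open>\<eta> ^ m = 1\<close>.\<close>
  obtain \<eta> where \<eta>: "\<eta> ^ m = 1" "\<eta> ^ (m div n) * u = w $ l"
  proof (cases "u = 0")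
    case True
    then show thesis using un assms that[of 1] by (auto simp: zero_power)
  next
    case False
    obtain \<eta> where *: "\<eta> ^ (m div n) = w $ l / u"
      using exists_complex_root[of "m div n" "w $ l / u"] assms by (metis div_greater_zero_iff dvd_imp_le gr0_implies_Suc nat.simps(3))
    have "\<eta> ^ m = (\<eta> ^ (m div n)) ^ n" using assms(3) by (simp add: power_mult[symmetric])
    also have "\<dots> = u ^ n / u ^ n" unfolding * un[symmetric] by (simp only: power_divide un)
    also have "\<dots> = 1" using False by simp
    finally show thesis using that * False by simp
  qed
  define z where "z = (\<chi> k. if k = l then \<eta> * y k else y k)"
  have zm: "z $ k ^ m = x k" for k by (simp add: z_def power_mult_distrib \<eta> y)
  have "(\<Prod>k\<in>UNIV. z $ k) = \<eta> * (\<Prod>k\<in>UNIV. y k)"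
  proof -
    have "(\<Prod>k\<in>UNIV. z $ k) = (\<Prod>k\<in>UNIV. (if k = l then \<eta> else 1) * y k)"
      by (intro prod.cong) (auto simp: z_def)
    also have "\<dots> = \<eta> * (\<Prod>k\<in>UNIV. y k)" by (simp add: prod.distrib)
    finally show ?thesis .
  qed
  then have last: "basic_map m n z $ l = w $ l"
    using \<eta>(2) by (simp add: basic_map_nth l_def power_mult_distrib u_def)
  have "basic_map m n z $ i = w $ i" for i
  proof (cases "i = l")
    case False
    then have r: "coord_rank i \<noteq> CARD('d)" using coord_rank_less_iff[of i] l_def by auto
    have "(SOME i'. coord_rank i' = coord_rank i) = i"
      by (rule some_equality) (auto simp: coord_rank_inj)
    then show ?thesis 
      using x[OF coord_rank_bounds] False r coord_rank_bounds[of i]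
      by (simp add: basic_map_nth zm sym_coeff_def l_def)
  qed (simp add: last)
  then show thesis using that[of z] by (simp add: vec_eq_iff)
qed

text \<open>Saturation of the polydisc: if \<open>z\<close> and \<open>y\<close> have the same
  image, each \<open>z $ i ^ m\<close> is a root of the polynomial with roots
  \<open>y $ k ^ m\<close>, so each \<open>z $ i\<close> has the modulus of some
  \<open>y $ k\<close>.\<close>

lemma basic_map_mem_image_iff:
  fixes z :: "complex^('d::{finite,linorder})"
  assumes "m > 0" "n dvd m"
  shows "basic_map m n z \<in> basic_map m n ` polydisc \<longleftrightarrow> z \<in> polydisc"
proof
  assume "basic_map m n z \<in> basic_map m n ` polydisc"
  then obtain y where y: "y \<in> polydisc" "basic_map m n z = basic_map m n y" by auto
  have "cmod (z $ i) < 1" for i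
  proof -
    have "(\<Prod>k\<in>UNIV. z $ i ^ m - y $ k ^ m) = (\<Prod>k\<in>UNIV. z $ i ^ m - z $ k ^ m)"
      by (simp add: basic_map_factors[OF assms(2)] y(2))
    also have "\<dots> = 0" by (auto intro!: exI[of _ i])
    finally obtain k where "z $ i ^ m = y $ k ^ m" by (auto simp: prod_zero_iff)
    then have "cmod (z $ i) ^ m = cmod (y $ k) ^ m" by (metis norm_power)
    then have "cmod (z $ i) = cmod (y $ k)" using assms(1) by (simp add: power_eq_iff_eq_base)
    then show ?thesis using y(1) by (auto simp: polydisc_def)
  qed
  then show "z \<in> polydisc" by (simp add: polydisc_def)
qed simp

lemma poly_fun_basic_map: "poly_fun (\<lambda>z. basic_map m n z $ i)"
  unfolding basic_map_nth elem_sym_def by (cases "i = last_idx") (auto intro!: poly_fun_intros)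

lemma continuous_on_basic_map: "continuous_on S (basic_map m n)"
  using continuous_on_vec_lambda[of S "\<lambda>i z. basic_map m n z $ i", OF poly_fun_continuous[OF poly_fun_basic_map]]
  by (simp add: vec_lambda_eta)

lemma open_polydisc: "open (polydisc :: (complex^'d::finite) set)"
proof -
  have "polydisc = (\<Inter>i. (\<lambda>z::complex^'d. z $ i) -` ball 0 1)" by (auto simp: polydisc_def)
  also have "open \<dots>" by (intro open_INT ballI open_vimage open_ball continuous_on_component) auto
  finally show ?thesis .
qed

text \<open>Cauchy's bound: for |t| > 1 every lower term is at most B |t|^(d-1), and this power of
  |t| cancels against |t|^d.\<close>

lemma monic_root_norm_bound:
  fixes t :: complex
  assumes "(\<Sum>j\<le>d. c j * t ^ (d - j)) = 0" "c 0 = 1" "\<And>j. cmod (c j) \<le> B" "d > 0"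
  shows "cmod t \<le> 1 + d * B"
proof (cases "cmod t \<le> 1")
  case False
  have B: "B \<ge> 0" using assms(3)[of 0] norm_ge_zero order_trans by blast
  obtain e where e: "d = Suc e" using assms(4) gr0_implies_Suc by blast
  have "t ^ d = - (\<Sum>j<d. c (Suc j) * t ^ (d - Suc j))"
    using assms(1,2) by (simp add: sum.atMost_shift add_eq_0_iff2)
  then have "cmod t ^ d = cmod (\<Sum>j<d. c (Suc j) * t ^ (d - Suc j))"
    by (simp flip: norm_power)
  also have "\<dots> \<le> (\<Sum>j<d. cmod (c (Suc j) * t ^ (d - Suc j)))"
    by (rule norm_sum)
  also have "\<dots> \<le> (\<Sum>j<d. B * cmod t ^ e)"
    unfolding norm_mult norm_power 
    by (intro sum_mono mult_mono assms B power_increasing) (use False e in auto)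
  finally have "cmod t * cmod t ^ e \<le> (d * B) * cmod t ^ e" by (simp add: e)
  moreover have "cmod t ^ e > 0" using False by (intro zero_less_power) auto
  ultimately have "cmod t \<le> d * B" by simp
  then show ?thesis by simp
next
  case True
  have "0 \<le> real d * B" using order_trans[OF norm_ge_zero assms(3)[of 0]] by simp
  with True show ?thesis by simp
qed

lemma open_basic_map_image:
  assumes "m > 0" "n > 0" "n dvd m"
  shows "open (basic_map m n ` (polydisc :: (complex^('d::{finite,linorder})) set))"
proof -
  let ?P = "polydisc :: (complex^('d::{finite,linorder})) set"
  \<comment> \<open>Surjectivity gives one inclusion and saturation the other; it remains to see
    that the image of a closed set is closed.\<close>
  have "- (basic_map m n ` ?P) = basic_map m n ` (- ?P)"
  proof (intro equalityI subsetI)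
    fix w assume "w \<in> - (basic_map m n ` ?P)"
    moreover obtain z where "basic_map m n z = w" using basic_map_surj[OF assms, of w] by metis
    ultimately show "w \<in> basic_map m n ` (- ?P)" by auto
  next
    fix w assume "w \<in> basic_map m n ` (- ?P)"
    then show "w \<in> - (basic_map m n ` ?P)" using basic_map_mem_image_iff[OF assms(1,3)] by auto
  qed
  moreover have "closed (basic_map m n ` (- ?P))"
    unfolding closed_sequential_limits
  proof (intro allI impI, elim conjE)
    fix x l assume x: "\<forall>k::nat. x k \<in> basic_map m n ` (- ?P)" and l: "x \<longlonglongrightarrow> l"
    from x have "\<forall>k. \<exists>z\<in>- ?P. x k = basic_map m n z" unfolding image_iff .
    then obtain z where "\<forall>k. z k \<in> - ?P \<and> x k = basic_map m n (z k)"
      unfolding Bex_def by (rule choice[THEN exE])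
    then have z: "\<And>k. z k \<notin> ?P" "\<And>k. basic_map m n (z k) = x k" by auto
    have "bounded (range x)" using l convergent_imp_bounded by blast
    then obtain B where B: "\<And>k. norm (x k) \<le> B" by (auto simp: bounded_iff)
    \<comment> \<open>A common bound for all Vieta coefficients: \<open>1\<close> for the leading
      one, \<open>B\<close> for those that are coordinates, \<open>B ^ n\<close> for the power of
      the last coordinate.\<close>
    define B' where "B' = 1 + B + B ^ n"
    have "B \<ge> 0" using B[of 0] norm_ge_zero order_trans by blast
    have xB: "cmod (x k $ i) \<le> B" for k i
      using Finite_Cartesian_Product.norm_nth_le[of "x k" i] B[of k] by linarith
    have coeffB: "cmod ((-1)^j * sym_coeff n (x k) j) \<le> B'" for k j
      using xB[of k] power_mono[OF xB[of k last_idx], of n] \<open>B \<ge> 0\<close> zero_le_power[of B n]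
      by (auto simp: sym_coeff_def B'_def norm_mult norm_power intro: order_trans[OF xB])
    \<comment> \<open>Properness: the \<open>z k $ i ^ m\<close> are roots of monic polynomials with
      bounded coefficients, so the preimages stay bounded and a subsequence converges.\<close>
    have zB: "cmod (z k $ i) \<le> 1 + CARD('d) * B'" for k i
    proof (cases "cmod (z k $ i) \<le> 1")
      case False
      have "(\<Sum>j\<le>CARD('d). ((-1)^j * sym_coeff n (x k) j) * (z k $ i ^ m) ^ (CARD('d) - j)) = 0"
        unfolding z(2)[symmetric] basic_map_factors[OF assms(3), symmetric]
        by (rule prod_zero) auto
      then have "cmod (z k $ i ^ m) \<le> 1 + CARD('d) * B'"
        by (rule monic_root_norm_bound) (use coeffB in \<open>auto simp: sym_coeff_def\<close>)
      moreover have "cmod (z k $ i) ^ 1 \<le> cmod (z k $ i) ^ m"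
        using False assms(1) by (intro power_increasing) auto
      ultimately show ?thesis by (simp add: norm_power)
    qed (use \<open>B \<ge> 0\<close> in \<open>auto simp: B'_def intro: order_trans\<close>)
    have "norm (z k) \<le> (\<Sum>i\<in>(UNIV::'d set). 1 + CARD('d) * B')" for k
      unfolding norm_vec_def by (rule order_trans[OF L2_set_le_sum sum_mono[OF zB]]) simp
    then have "bounded (range z)" unfolding bounded_iff by blast
    then obtain y r where r: "strict_mono (r::nat\<Rightarrow>nat)" "(z \<circ> r) \<longlonglongrightarrow> y"
      using bounded_imp_convergent_subsequence by blast
    have "y \<in> - ?P"
      using closed_sequentially[of "- ?P" "z \<circ> r" y] open_polydisc z(1) r(2) by auto
    moreover have "(\<lambda>k. basic_map m n ((z \<circ> r) k)) \<longlonglongrightarrow> basic_map m n y"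
      by (rule continuous_on_tendsto_compose[OF continuous_on_basic_map[of UNIV] r(2)]) auto
    then have "(x \<circ> r) \<longlonglongrightarrow> basic_map m n y" by (simp add: z(2) o_def)
    then have "basic_map m n y = l"
      using LIMSEQ_subseq_LIMSEQ[OF l r(1)] LIMSEQ_unique by blast
    ultimately show "l \<in> basic_map m n ` (- ?P)" by blast
  qed
  ultimately show ?thesis using open_closed by metis
qed

section \<open>Normal families\<close>

text \<open>Tychonoff's theorem for a product of closed discs, the function type carrying the
  product topology.\<close>

lemma compact_Pi_cball:
  fixes B :: "'i \<Rightarrow> real"
  shows "compact {g :: 'i \<Rightarrow> complex. \<forall>i. g i \<in> cball 0 (B i)}"
proof -
  have "compactin (product_topology (\<lambda>i. euclidean) UNIV) (PiE UNIV (\<lambda>i. cball (0::complex) (B i)))"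
    by (subst compactin_PiE) auto
  moreover have "PiE UNIV (\<lambda>i. cball (0::complex) (B i)) = {g. \<forall>i. g i \<in> cball 0 (B i)}" by auto
  ultimately show ?thesis by (simp add: euclidean_product_topology)
qed

text \<open>Over an uncountable index set a bounded sequence of functions need not have a pointwise
  convergent subsequence. A cluster point in the product always exists, and convergence to it takes
  place along a filter finer than \<open>sequentially\<close>.\<close>

lemma pointwise_cluster_point:
  fixes G :: "nat \<Rightarrow> 'i \<Rightarrow> complex"
  assumes "\<And>k i. cmod (G k i) \<le> B i"
  obtains g F where "F \<noteq> bot" "F \<le> sequentially" "\<And>i. ((\<lambda>k. G k i) \<longlongrightarrow> g i) F"
proof -
  let ?K = "{g :: 'i \<Rightarrow> complex. \<forall>i. g i \<in> cball 0 (B i)}"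
  have "eventually (\<lambda>x. x \<in> ?K) (filtermap G sequentially)"
    using assms by (simp add: eventually_filtermap)
  moreover have "filtermap G sequentially \<noteq> bot" by (simp add: filtermap_bot_iff)
  ultimately obtain g where g: "inf (nhds g) (filtermap G sequentially) \<noteq> bot"
    using compact_filter[THEN iffD1, OF compact_Pi_cball[of B]] by meson
  \<comment> \<open>Large indices whose functions lie near \<open>g\<close>; this filter is proper
    precisely because \<open>g\<close> is a cluster point.\<close>
  define F where "F = inf sequentially (filtercomap G (nhds g))"
  have "F \<noteq> bot"
  proof
    assume "F = bot"
    then have "eventually (\<lambda>_. False) F" by simp
    then obtain P Q where PQ: "eventually P sequentially" "eventually Q (nhds g)" "\<And>k. P k \<Longrightarrow> \<not> Q (G k)"
      unfolding F_def eventually_inf eventually_filtercomap by blast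
    have "eventually (\<lambda>h. \<exists>k. P k \<and> h = G k) (filtermap G sequentially)"
      unfolding eventually_filtermap by (rule eventually_mono[OF PQ(1)]) auto
    with PQ have "eventually (\<lambda>_. False) (inf (nhds g) (filtermap G sequentially))"
      unfolding eventually_inf by blast
    with g show False by (simp add: trivial_limit_def)
  qed
  moreover have "((\<lambda>k. G k i) \<longlongrightarrow> g i) F" for i
  proof -
    have "((\<lambda>h. h i) \<longlongrightarrow> g i) (nhds g)"
    proof (rule topological_tendstoI)
      fix T :: "complex set" assume T: "open T" "g i \<in> T"
      have "open ((\<lambda>h::'i \<Rightarrow> complex. h i) -` T)"
        by (rule open_vimage[OF T(1) continuous_on_product_coordinates])
      then show "\<forall>\<^sub>F h in nhds g. h i \<in> T"
        unfolding eventually_nhds using T(2) by (intro exI[of _ "(\<lambda>h. h i) -` T"]) auto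
    qed
    then have "filterlim G (nhds g) F \<Longrightarrow> ?thesis"
      by (rule filterlim_compose)
    moreover have "filterlim G (nhds g) F"
      unfolding F_def filterlim_iff_le_filtercomap by simp
    ultimately show ?thesis by blast
  qed
  moreover have "F \<le> sequentially" by (simp add: F_def)
  ultimately show thesis using that by blast
qed

section \<open>Taylor estimates uniform over functions bounded by one\<close>

lemma Taylor_remainder_bound:
  assumes f: "f holomorphic_on ball 0 R" and b: "\<And>x. x \<in> ball 0 R \<Longrightarrow> cmod (f x) \<le> 1" and R: "R > 2"
  shows "cmod (f 1 - f 0 - deriv f 0) \<le> 32 / R ^ 2"
proof -
  \<comment> \<open>Circles of radius \<open>R / 4\<close> about points of the unit disc stay inside
    the ball, as \<open>1 + R / 4 < R\<close> for \<open>R > 2\<close>; Cauchy's bound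
    \<open>2 / r ^ 2\<close> for the second derivative is then \<open>32 / R ^ 2\<close>.\<close>
  define r where "r = R / 4"
  have d2: "cmod (deriv (deriv f) x) \<le> 32 / R ^ 2" if x: "x \<in> cball 0 1" for x
  proof -
    have sub: "cball x r \<subseteq> ball 0 R"
    proof
      fix y assume "y \<in> cball x r"
      then have "cmod y \<le> 1 + r" using x norm_triangle_ineq2[of y x] by (auto simp: dist_norm norm_minus_commute)
      then show "y \<in> ball 0 R" using R by (auto simp: r_def)
    qed
    have "cmod ((deriv ^^ 2) f x) \<le> fact 2 * 1 / r ^ 2"
    proof (rule Cauchy_inequality)
      show "f holomorphic_on ball x r" using sub f holomorphic_on_subset ball_subset_cball by blast
      show "continuous_on (cball x r) f" using sub f holomorphic_on_subset holomorphic_on_imp_continuous_on by blast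
      show "0 < r" using R by (simp add: r_def)
      show "cmod (f y) \<le> 1" if "cmod (x - y) = r" for y
        by (rule b) (use that sub in \<open>auto simp: dist_norm\<close>)
    qed
    then show ?thesis by (simp add: r_def power_divide numeral_2_eq_2)
  qed
  have "cmod ((deriv ^^ 0) f 1 - (\<Sum>i\<le>1. (deriv ^^ i) f 0 * (1 - 0) ^ i / fact i)) \<le> (32 / R^2) * cmod (1 - 0) ^ Suc 1 / fact 1"
  proof (rule complex_Taylor[where S = "cball 0 1"])
    fix i x assume "x \<in> cball (0::complex) 1"
    then have "x \<in> ball 0 R" using R by auto
    then show "((deriv ^^ i) f has_field_derivative (deriv ^^ Suc i) f x) (at x within cball 0 1)"
      using holomorphic_derivI[OF holomorphic_higher_deriv[OF f open_ball] open_ball, of x i]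
      by (auto intro: has_field_derivative_at_within)
  qed (use d2 in \<open>auto simp: numeral_2_eq_2\<close>)
  then show ?thesis by (simp add: algebra_simps)
qed

lemma norm_vector_smult: "norm (c *s v) = cmod c * norm (v :: complex^'d)"
  by (simp add: norm_vec_def norm_mult L2_set_right_distrib)

text \<open>Restriction to the complex line through \<open>z\<close> in direction \<open>h\<close>
  gives a function on a disc of radius \<open>R = \<rho> / norm h\<close>, and the one-variable
  remainder \<open>32 / R ^ 2\<close> becomes quadratic in \<open>h\<close>;
  \<open>norm h < \<rho> / 2\<close> is the condition \<open>R > 2\<close>. The constants depend on
  \<rho> only, so they survive limits of functions.\<close>

lemma mv_holomorphic_on_Taylor:
  fixes f :: "complex^'d \<Rightarrow> complex"
  assumes f: "mv_holomorphic_on f S" and S: "open S" "ball z \<rho> \<subseteq> S" "\<rho> > 0"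
    and b: "\<And>z. z \<in> S \<Longrightarrow> cmod (f z) \<le> 1"
  obtains L where "bounded_linear L" "\<And>c v. L (c *s v) = c * L v"
    "\<And>v. cmod (L v) \<le> 4 / \<rho> * norm v"
    "\<And>h. norm h < \<rho> / 2 \<Longrightarrow> cmod (f (z + h) - f z - L h) \<le> 32 / \<rho>^2 * norm h ^ 2"
proof -
  have z: "z \<in> S" using S by auto
  then obtain L where L: "(f has_derivative L) (at z)" "\<And>c v. L (c *s v) = c * L v"
    using f S(1) unfolding mv_holomorphic_on_def by (metis at_within_open)
  have slice: "(\<lambda>x. f (z + x *s v)) holomorphic_on ball 0 (\<rho> / norm v)" 
    and slice_bound: "\<And>x. x \<in> ball 0 (\<rho> / norm v) \<Longrightarrow> cmod (f (z + x *s v)) \<le> 1"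
    and slice_deriv: "deriv (\<lambda>x. f (z + x *s v)) 0 = L v" if v: "v \<noteq> 0" for v
  proof -
    have sub: "z + x *s v \<in> S" if "x \<in> ball 0 (\<rho> / norm v)" for x
      by (rule subsetD[OF S(2)]) (use that v in \<open>simp add: dist_norm norm_vector_smult field_simps\<close>)
    then show "\<And>x. x \<in> ball 0 (\<rho> / norm v) \<Longrightarrow> cmod (f (z + x *s v)) \<le> 1" using b by blast
    show "(\<lambda>x. f (z + x *s v)) holomorphic_on ball 0 (\<rho> / norm v)"
      by (rule mv_holomorphic_on_compose_curve[OF f open_ball])
        (use sub in \<open>auto intro!: holomorphic_intros\<close>)
    have "((\<lambda>x::complex. z + x *s v) has_derivative (\<lambda>x. x *s v)) (at 0)"
    proof -
      have "bounded_linear (\<lambda>x::complex. x *s v)"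
        by (intro bounded_linear_intro[where K="norm v"])
          (auto simp: vec_eq_iff algebra_simps norm_vector_smult)
      then show ?thesis by (auto intro!: derivative_eq_intros bounded_linear_imp_has_derivative)
    qed
    then have "((\<lambda>x. f (z + x *s v)) has_derivative (\<lambda>x. L (x *s v))) (at 0)"
      by (rule has_derivative_compose) (use L in simp)
    then have "((\<lambda>x. f (z + x *s v)) has_field_derivative L v) (at 0)"
      unfolding L(2) has_field_derivative_def by (simp add: mult.commute[of _ "L v"])
    then show "deriv (\<lambda>x. f (z + x *s v)) 0 = L v" by (rule DERIV_imp_deriv)
  qed
  have L0: "L 0 = 0" using L(2)[of 0 0] by simp
  have "cmod (L v) \<le> 4 / \<rho> * norm v" for v
  proof (cases "v = 0")
    case False
    let ?r = "\<rho> / (2 * norm v)"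
    have sub: "cball 0 ?r \<subseteq> ball (0::complex) (\<rho> / norm v)" using False S(3) by (auto simp: field_simps)
    have "cmod ((deriv ^^ 1) (\<lambda>x. f (z + x *s v)) 0) \<le> fact 1 * 1 / ?r ^ 1"
    proof (rule Cauchy_inequality)
      show "(\<lambda>x. f (z + x *s v)) holomorphic_on ball 0 ?r"
        by (rule holomorphic_on_subset[OF slice[OF False]]) (use sub ball_subset_cball in blast)
      show "continuous_on (cball 0 ?r) (\<lambda>x. f (z + x *s v))"
        by (rule holomorphic_on_imp_continuous_on[OF holomorphic_on_subset[OF slice[OF False] sub]])
      show "0 < ?r" using S(3) False by simp
      show "cmod (f (z + x *s v)) \<le> 1" if "cmod (0 - x) = ?r" for x
        by (rule slice_bound[OF False]) (use that subsetD[OF sub, of x] in auto)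
    qed
    moreover have "2 * norm v / \<rho> \<le> 4 / \<rho> * norm v" using S(3) by (simp add: field_simps)
    ultimately show ?thesis using slice_deriv[OF False] by simp
  qed (simp add: L0)
  moreover have "cmod (f (z + h) - f z - L h) \<le> 32 / \<rho>^2 * norm h ^ 2" if h: "norm h < \<rho> / 2" for h
  proof (cases "h = 0")
    case False
    have "cmod (f (z + 1 *s h) - f (z + 0 *s h) - deriv (\<lambda>x. f (z + x *s h)) 0) \<le> 32 / (\<rho> / norm h) ^ 2"
      by (rule Taylor_remainder_bound[OF slice[OF False] slice_bound[OF False]])
        (use h False in \<open>auto simp: field_simps\<close>)
    then show ?thesis by (simp add: slice_deriv[OF False] power_divide)
  qed (simp add: L0)
  ultimately show thesis using that[of L] L has_derivative_bounded_linear by blast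
qed

text \<open>Montel's theorem with convergence along a filter instead of a subsequence. The cluster point,
  provided by Tychonoff's theorem, is taken simultaneously for the values and for all directional
  derivatives; the Taylor estimate is uniform in \<open>k\<close> and hence passes to the limit.\<close>

lemma mv_Montel:
  fixes f :: "nat \<Rightarrow> complex^'d \<Rightarrow> complex"
  assumes S: "open S" and f: "\<And>k. mv_holomorphic_on (f k) S"
    and b: "\<And>k z. z \<in> S \<Longrightarrow> cmod (f k z) \<le> 1"
  obtains \<phi> F where "F \<noteq> bot" "F \<le> sequentially" "mv_holomorphic_on \<phi> S"
    "\<And>z. z \<in> S \<Longrightarrow> ((\<lambda>k. f k z) \<longlongrightarrow> \<phi> z) F"
proof -
  have "\<exists>\<rho>>0. ball z \<rho> \<subseteq> S" if "z \<in> S" for z using S that by (rule openE) blast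
  then obtain \<rho> where \<rho>: "\<And>z. z \<in> S \<Longrightarrow> \<rho> z > 0 \<and> ball z (\<rho> z) \<subseteq> S" by metis
  define Q where "Q k z L \<longleftrightarrow> bounded_linear L \<and> (\<forall>c v. L (c *s v) = c * L v) \<and>
    (\<forall>v. cmod (L v) \<le> 4 / \<rho> z * norm v) \<and>
    (\<forall>h. norm h < \<rho> z / 2 \<longrightarrow> cmod (f k (z + h) - f k z - L h) \<le> 32 / (\<rho> z)^2 * norm h ^ 2)" for k z L
  have "\<exists>L. Q k z L" if z: "z \<in> S" for k z
  proof -
    obtain L where "bounded_linear L" "\<And>c v. L (c *s v) = c * L v"
      "\<And>v. cmod (L v) \<le> 4 / \<rho> z * norm v"
      "\<And>h. norm h < \<rho> z / 2 \<Longrightarrow> cmod (f k (z + h) - f k z - L h) \<le> 32 / (\<rho> z)^2 * norm h ^ 2"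
      using mv_holomorphic_on_Taylor[OF f[of k] S _ _ b[of _ k], of z "\<rho> z"] \<rho>[OF z] by blast
    then have "Q k z L" unfolding Q_def by simp
    then show ?thesis by blast
  qed
  then have "\<forall>k z. \<exists>L. z \<in> S \<longrightarrow> Q k z L" by simp
  then obtain L where L: "\<And>k z. z \<in> S \<Longrightarrow> Q k z (L k z)" by metis
  \<comment> \<open>One index set for two families: \<open>(z, None)\<close> stands for the value at
    \<open>z\<close>, \<open>(z, Some v)\<close> for the derivative at \<open>z\<close> in direction
    \<open>v\<close>. The default 0 off \<open>S\<close> keeps every entry bounded.\<close>
  define G where "G k i = (if fst i \<in> S then (case snd i of None \<Rightarrow> f k (fst i) | Some v \<Rightarrow> L k (fst i) v) else 0)" for k i
  define B :: "(complex^'d) \<times> (complex^'d) option \<Rightarrow> real" where "B i = (if fst i \<in> S then (case snd i of None \<Rightarrow> 1 | Some v \<Rightarrow> 4 / \<rho> (fst i) * norm v) else 0)" for i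
  have bnd: "cmod (G k i) \<le> B i" for k i
    unfolding G_def B_def using L b by (auto simp: Q_def split: option.splits)
  obtain g F where F: "F \<noteq> bot" "F \<le> sequentially" "\<And>i. ((\<lambda>k. G k i) \<longlongrightarrow> g i) F"
    by (rule pointwise_cluster_point[of G B, OF bnd]) blast
  define \<phi> where "\<phi> z = g (z, None)" for z
  define D where "D z v = g (z, Some v)" for z v
  have lim\<phi>: "((\<lambda>k. f k z) \<longlongrightarrow> \<phi> z) F" if "z \<in> S" for z
    using F(3)[of "(z, None)"] that by (simp add: G_def \<phi>_def)
  have limD: "((\<lambda>k. L k z v) \<longlongrightarrow> D z v) F" if "z \<in> S" for z v
    using F(3)[of "(z, Some v)"] that by (simp add: G_def D_def)
  have "mv_holomorphic_on \<phi> S" unfolding mv_holomorphic_on_def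
  proof
    fix z assume z: "z \<in> S"
    have r: "\<rho> z > 0" "ball z (\<rho> z) \<subseteq> S" using \<rho>[OF z] by auto
    have smult: "D z (c *s v) = c * D z v" for c v
    proof (rule tendsto_unique[OF F(1) limD[OF z]])
      show "((\<lambda>k. L k z (c *s v)) \<longlongrightarrow> c * D z v) F"
        using tendsto_mult_left[OF limD[OF z], of c] L[OF z] by (simp add: Q_def)
    qed
    have bl: "bounded_linear (D z)"
    proof (rule bounded_linear_intro)
      show "D z (x + y) = D z x + D z y" for x y
      proof (rule tendsto_unique[OF F(1) limD[OF z]])
        have "L k z (x + y) = L k z x + L k z y" for k
          using L[OF z, of k] by (simp add: Q_def linear_simps)
        then show "((\<lambda>k. L k z (x + y)) \<longlongrightarrow> D z x + D z y) F"
          using tendsto_add[OF limD[OF z] limD[OF z]] by simp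
      qed
      show "D z (r *\<^sub>R x) = r *\<^sub>R D z x" for r x
        using smult[of "of_real r" x] by (simp add: scaleR_vec_def vector_scalar_mult_def scaleR_conv_of_real)
      show "norm (D z x) \<le> norm x * (4 / \<rho> z)" for x
      proof (rule tendsto_upperbound[OF tendsto_norm[OF limD[OF z]] _ F(1)])
        show "\<forall>\<^sub>F k in F. norm (L k z x) \<le> norm x * (4 / \<rho> z)"
          using L[OF z] by (intro always_eventually) (simp add: Q_def mult.commute)
      qed
    qed
    have T: "cmod (\<phi> (z + h) - \<phi> z - D z h) \<le> 32 / (\<rho> z)^2 * norm h ^ 2" if h: "norm h < \<rho> z / 2" for h
    proof (rule tendsto_upperbound[OF _ _ F(1)])
      have "z + h \<in> S" by (rule subsetD[OF r(2)]) (use h r in \<open>auto simp: dist_norm\<close>)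
      then show "((\<lambda>k. cmod (f k (z + h) - f k z - L k z h)) \<longlongrightarrow> cmod (\<phi> (z + h) - \<phi> z - D z h)) F"
        by (intro tendsto_intros lim\<phi> limD z)
      show "\<forall>\<^sub>F k in F. cmod (f k (z + h) - f k z - L k z h) \<le> 32 / (\<rho> z)^2 * norm h ^ 2"
        using L[OF z] h by (intro always_eventually) (simp add: Q_def)
    qed
    have "(\<phi> has_derivative D z) (at z within S)"
    proof (rule has_derivativeI_sandwich[where e = "\<rho> z / 2" and H = "\<lambda>y. 32 / (\<rho> z)^2 * norm (y - z)"])
      show "norm ((\<phi> y - \<phi> z) - D z (y - z)) / norm (y - z) \<le> 32 / (\<rho> z)^2 * norm (y - z)"
        if "y \<noteq> z" "dist y z < \<rho> z / 2" for y
        using T[of "y - z"] that by (simp add: dist_norm divide_le_eq power2_eq_square mult.assoc)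
      have "((\<lambda>y. 32 / (\<rho> z)^2 * norm (y - z)) \<longlongrightarrow> 32 / (\<rho> z)^2 * norm (z - z)) (at z within S)"
        by (intro tendsto_intros)
      then show "((\<lambda>y. 32 / (\<rho> z)^2 * norm (y - z)) \<longlongrightarrow> 0) (at z within S)" by simp
    qed (use r bl in auto)
    with smult show "\<exists>L. (\<phi> has_derivative L) (at z within S) \<and> (\<forall>c v. L (c *s v) = c * L v)" by blast
  qed
  with F lim\<phi> that show thesis by blast
qed

section \<open>Inner functions are bounded by one\<close>

text \<open>Cauchy's formula on the unit circle, where the kernel is at most
  \<open>1 / (1 - cmod z)\<close>. The constant is crude but the same for all \<open>g\<close>,
  which is what an argument by powers of a function requires.\<close>

lemma Cauchy_mean_bound:
  assumes g: "g holomorphic_on ball 0 R" and R: "R > 1" and z: "cmod z < 1"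
  shows "ennreal (cmod (g z)) \<le> ennreal (1 / (2 * pi * (1 - cmod z))) *
    (\<integral>\<^sup>+ t. ennreal (cmod (g (cis t))) * indicator {0..2*pi} t \<partial>lborel)"
proof -
  have cb: "cball 0 1 \<subseteq> ball (0::complex) R" using R by auto
  have cont: "continuous_on {0..2*pi} (\<lambda>t. g (cis t))"
    by (rule continuous_on_compose2[OF holomorphic_on_imp_continuous_on[OF g]])
      (use R in \<open>auto intro!: continuous_intros\<close>)
  have nz: "cis t - z \<noteq> 0" for t using z by (auto simp: norm_cis dest: arg_cong[where f=cmod])
  have dist: "cmod (cis t - z) \<ge> 1 - cmod z" for t using norm_triangle_ineq2[of "cis t" z] by simp
  have "((\<lambda>u. g u / (u - z)) has_contour_integral (2 * of_real pi * \<i> * g z)) (circlepath 0 1)"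
    by (rule Cauchy_integral_circlepath_simple) (use holomorphic_on_subset[OF g cb] z in auto)
  then have I: "((\<lambda>t. g (cis t) / (cis t - z) * \<i> * cis t) has_integral (2 * of_real pi * \<i> * g z)) {0..2*pi}"
    unfolding circlepath_def by (subst (asm) has_contour_integral_part_circlepath_iff) auto
  define J where "J = integral {0..2*pi} (\<lambda>t. cmod (g (cis t)))"
  have J: "((\<lambda>t. cmod (g (cis t))) has_integral J) {0..2*pi}"
    unfolding J_def by (intro integrable_integral integrable_continuous_real continuous_intros cont)
  have "norm (2 * of_real pi * \<i> * g z) \<le> J * (1 / (1 - cmod z))"
    unfolding integral_unique[OF I, symmetric] integral_unique[OF has_integral_mult_left[OF J], symmetric]
  proof (rule integral_norm_bound_integral[OF has_integral_integrable[OF I] has_integral_integrable[OF has_integral_mult_left[OF J]]])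
    fix t
    show "norm (g (cis t) / (cis t - z) * \<i> * cis t) \<le> cmod (g (cis t)) * (1 / (1 - cmod z))"
      using dist[of t] z nz[of t]
      by (auto simp: norm_mult norm_divide intro!: divide_left_mono mult_pos_pos)
  qed
  then have "cmod (g z) \<le> (1 / (2 * pi * (1 - cmod z))) * J"
    using z by (simp add: norm_mult field_simps)
  moreover have "(\<integral>\<^sup>+ t. ennreal (cmod (g (cis t))) * indicator {0..2*pi} t \<partial>lborel) = ennreal J"
    by (rule nn_integral_has_integral_lebesgue'[OF _ J]) simp
  moreover have "J \<ge> 0" using has_integral_nonneg[OF J] by simp
  ultimately show ?thesis using z by (simp flip: ennreal_mult)
qed

lemma measurable_vec_lambda:
  fixes f :: "'d::finite \<Rightarrow> 'a \<Rightarrow> complex"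
  assumes [measurable]: "\<And>i. f i \<in> borel_measurable M"
  shows "(\<lambda>t. \<chi> i. f i t) \<in> borel_measurable M"
proof -
  have [measurable]: "(axis i :: complex \<Rightarrow> complex^'d) \<in> borel_measurable borel" for i
  proof -
    have "continuous_on UNIV (\<lambda>x::complex. if k = i then x else 0)" for k
      by (cases "k = i") auto
    then show ?thesis
      unfolding axis_def by (intro borel_measurable_continuous_onI continuous_on_vec_lambda)
  qed
  have "(\<lambda>t. \<chi> i. f i t) = (\<lambda>t. \<Sum>i\<in>UNIV. axis i (f i t))"
    by (auto simp: vec_eq_iff axis_def fun_eq_iff)
  also have "\<dots> \<in> borel_measurable M" by measurable
  finally show ?thesis .
qed

text \<open>The one-variable bound is iterated over the coordinates by Tonelli, each contributing a
  factor \<open>C\<close>. Accordingly \<open>step\<close> admits other coordinates anywhere in the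
  closed disc, since some of them already run over the circle, and restricts only the coordinate
  being replaced.\<close>

lemma torus_mean_bound:
  fixes G :: "complex^'d \<Rightarrow> real" and C :: ennreal
  assumes [measurable]: "G \<in> borel_measurable borel"
    and step: "\<And>z i. (\<And>k. cmod (z $ k) \<le> 1) \<Longrightarrow> cmod (z $ i) \<le> \<rho> \<Longrightarrow>
      ennreal (G z) \<le> C * (\<integral>\<^sup>+ t. ennreal (G (vec_upd z i (cis t))) * indicator {0..2*pi} t \<partial>lborel)"
    and \<rho>: "\<rho> \<le> 1" and z: "\<And>k. cmod (z $ k) \<le> \<rho>"
  shows "ennreal (G z) \<le> C ^ CARD('d) *
    (\<integral>\<^sup>+ t. ennreal (G (\<chi> i. cis (t $ i))) * indicator (cbox 0 (\<chi> i. 2 * pi)) t \<partial>(lborel :: (real^'d) measure))"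
proof -
  \<comment> \<open>The integration variables are indexed by basis vectors, because
    \<open>lborel\<close> on \<open>real^'d\<close> is the image of the product measure over
    \<open>Basis\<close>.\<close>
  define ax :: "'d \<Rightarrow> real^'d" where "ax i = axis i 1" for i
  have ax_inj: "ax i = ax j \<longleftrightarrow> i = j" for i j by (simp add: ax_def axis_eq_axis)
  \<comment> \<open>Coordinates in \<open>A\<close> have been moved to the circle, the others are
    still those of \<open>z\<close>.\<close>
  define Z where "Z A t = (\<chi> i. if i \<in> A then cis (t (ax i)) else z $ i)" for A and t :: "real^'d \<Rightarrow> real"
  define K where "K A t = (\<Prod>b\<in>ax ` A. indicator {0..2*pi} (t b) :: ennreal)" for A and t :: "real^'d \<Rightarrow> real"
  interpret product_sigma_finite "\<lambda>_::real^'d. lborel :: real measure" by standard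
  have Z_meas [measurable]: "Z A \<in> borel_measurable (PiM (ax ` B) (\<lambda>_. lborel))" if "A \<subseteq> B" for A B
  proof -
    have "(\<lambda>t. if i \<in> A then cis (t (ax i)) else z $ i) \<in> borel_measurable (PiM (ax ` B) (\<lambda>_. lborel))" for i
    proof (cases "i \<in> A")
      case True
      with that have [simp]: "ax i \<in> ax ` B" by auto
      have [measurable]: "cis \<in> borel_measurable borel"
        by (intro borel_measurable_continuous_onI continuous_intros)
      show ?thesis using True by simp
    qed simp
    then show ?thesis unfolding Z_def[abs_def] by (rule measurable_vec_lambda)
  qed
  have K_meas [measurable]: "K A \<in> borel_measurable (PiM (ax ` A) (\<lambda>_. lborel))" for A
    unfolding K_def[abs_def] by (intro borel_measurable_prod_ennreal) measurable
  have main: "ennreal (G z) \<le> C ^ card A * (\<integral>\<^sup>+ t. ennreal (G (Z A t)) * K A t \<partial>PiM (ax ` A) (\<lambda>_. lborel))" for A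
  proof (induction A rule: finite_induct[OF finite])
    case 1
    have "Z {} t = z" for t by (simp add: Z_def vec_eq_iff)
    then show ?case by (simp add: K_def space_PiM_empty emeasure_PiM_empty)
  next
    case (2 j A)
    let ?P = "PiM (ax ` A) (\<lambda>_. lborel :: real measure)"
    let ?Q = "PiM (ax ` insert j A) (\<lambda>_. lborel :: real measure)"
    define h where "h t = C * (ennreal (G (Z (insert j A) t)) * K (insert j A) t)" for t
    have h_meas: "h \<in> borel_measurable ?Q"
      using Z_meas[of "insert j A" "insert j A"] K_meas[of "insert j A"] unfolding h_def[abs_def] by measurable
    have notin: "ax j \<notin> ax ` A" using 2(2) ax_inj by auto
    have "ennreal (G (Z A t)) * K A t \<le> (\<integral>\<^sup>+ x. h (t(ax j := x)) \<partial>lborel)" if t: "t \<in> space ?P" for t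
    proof -
      have Zup: "vec_upd (Z A t) j (cis x) = Z (insert j A) (t(ax j := x))" for x
        by (rule vec_eq_iff[THEN iffD2]) (use 2(2) in \<open>auto simp: Z_def ax_inj\<close>)
      have Kup: "K (insert j A) (t(ax j := x)) = indicator {0..2*pi} x * K A t" for x
      proof -
        have "(\<Prod>b\<in>ax ` A. indicator {0..2*pi} ((t(ax j := x)) b) :: ennreal) = K A t"
          unfolding K_def by (intro prod.cong refl) (use notin in \<open>metis fun_upd_other\<close>)
        then show ?thesis using notin 2(1) by (simp add: K_def)
      qed
      have [measurable]: "(\<lambda>x. G (Z (insert j A) (t(ax j := x)))) \<in> borel_measurable lborel"
      proof -
        have "(\<lambda>x. t(ax j := x)) \<in> measurable lborel ?Q"
          using measurable_component_update[OF t notin] by simp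
        from measurable_compose[OF this Z_meas[OF subset_refl]] show ?thesis by measurable
      qed
      have "ennreal (G (Z A t)) \<le> C * (\<integral>\<^sup>+ x. ennreal (G (Z (insert j A) (t(ax j := x)))) * indicator {0..2*pi} x \<partial>lborel)"
        unfolding Zup[symmetric]
        by (rule step) (use 2(2) z \<rho> in \<open>auto simp: Z_def intro: order_trans\<close>)
      then have "ennreal (G (Z A t)) * K A t \<le>
          C * (\<integral>\<^sup>+ x. ennreal (G (Z (insert j A) (t(ax j := x)))) * indicator {0..2*pi} x \<partial>lborel) * K A t"
        by (rule mult_right_mono) simp
      also have "\<dots> = C * (\<integral>\<^sup>+ x. ennreal (G (Z (insert j A) (t(ax j := x)))) * indicator {0..2*pi} x * K A t \<partial>lborel)"
        by (subst nn_integral_multc) (auto simp: mult.assoc)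
      also have "\<dots> = (\<integral>\<^sup>+ x. h (t(ax j := x)) \<partial>lborel)"
        unfolding h_def Kup by (subst nn_integral_cmult[symmetric]) (auto simp: mult_ac)
      finally show ?thesis .
    qed
    then have "(\<integral>\<^sup>+ t. ennreal (G (Z A t)) * K A t \<partial>?P) \<le> (\<integral>\<^sup>+ t. (\<integral>\<^sup>+ x. h (t(ax j := x)) \<partial>lborel) \<partial>?P)"
      by (rule nn_integral_mono)
    also have "\<dots> = (\<integral>\<^sup>+ t. h t \<partial>?Q)"
      using product_nn_integral_insert[of "ax ` A" "ax j" h] notin 2(1) h_meas by simp
    also have "\<dots> = C * (\<integral>\<^sup>+ t. ennreal (G (Z (insert j A) t)) * K (insert j A) t \<partial>?Q)"
      unfolding h_def using Z_meas[of "insert j A" "insert j A"] K_meas[of "insert j A"]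
      by (intro nn_integral_cmult) measurable
    finally have "C ^ card A * (\<integral>\<^sup>+ t. ennreal (G (Z A t)) * K A t \<partial>?P)
        \<le> C ^ card A * (C * (\<integral>\<^sup>+ t. ennreal (G (Z (insert j A) t)) * K (insert j A) t \<partial>?Q))"
      by (rule mult_left_mono) simp
    with 2 show ?case by (simp add: mult_ac order_trans)
  qed
  have Basis: "ax ` UNIV = Basis" by (auto simp: Basis_vec_def ax_def)
  let ?s = "\<lambda>t::real^'d \<Rightarrow> real. \<Sum>b\<in>Basis. t b *\<^sub>R b"
  have s_nth: "?s t $ i = t (ax i)" for t i
  proof -
    have "?s t $ i = ?s t \<bullet> ax i" by (simp add: ax_def cart_eq_inner_axis)
    also have "\<dots> = t (ax i)" using Basis by (subst inner_sum_left_Basis) auto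
    finally show ?thesis .
  qed
  have [measurable]: "(\<lambda>t::real^'d. \<chi> i. cis (t $ i)) \<in> borel_measurable borel"
    by (rule measurable_torus_param)
  have "(\<integral>\<^sup>+ t. ennreal (G (\<chi> i. cis (t $ i))) * indicator (cbox 0 (\<chi> i. 2 * pi)) t \<partial>(lborel :: (real^'d) measure))
      = (\<integral>\<^sup>+ t. ennreal (G (\<chi> i. cis (?s t $ i))) * indicator (cbox 0 (\<chi> i. 2 * pi)) (?s t) \<partial>PiM Basis (\<lambda>_. lborel))"
    by (subst lborel_eq, subst nn_integral_distr) measurable
  also have "\<dots> = (\<integral>\<^sup>+ t. ennreal (G (Z UNIV t)) * K UNIV t \<partial>PiM Basis (\<lambda>_. lborel))"
  proof (intro nn_integral_cong arg_cong2[where f="(*)"])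
    fix t :: "real^'d \<Rightarrow> real"
    show "ennreal (G (\<chi> i. cis (?s t $ i))) = ennreal (G (Z UNIV t))"
      unfolding s_nth by (simp add: Z_def)
    have "(\<Prod>i\<in>(UNIV::'d set). indicator {0..2*pi} (t (ax i)) :: ennreal) = indicator (cbox 0 (\<chi> i. 2 * pi)) (?s t)"
    proof -
      have "?s t \<in> cbox 0 (\<chi> i. 2 * pi) \<longleftrightarrow> (\<forall>i. t (ax i) \<in> {0..2*pi})"
        unfolding mem_box_cart s_nth by simp
      then show ?thesis
        by (cases "\<forall>i. t (ax i) \<in> {0..2*pi}")
          (auto simp del: atLeastAtMost_iff intro!: prod_zero intro: indicator_simps(2))
    qed
    then show "indicator (cbox 0 (\<chi> i. 2 * pi)) (?s t) = K UNIV t"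
      unfolding K_def by (subst prod.reindex) (auto simp: inj_on_def ax_inj)
  qed
  finally show ?thesis using main[of UNIV] by (simp add: Basis)
qed


text \<open>The mean bound is applied to \<open>F ^ N\<close>; as its constant does not depend on \<open>N\<close>, letting
  \<open>N\<close> tend to infinity removes it.\<close>

lemma inner_function_norm_le_1:
  fixes F :: "complex^'d \<Rightarrow> complex"
  assumes F: "inner_function F" and z: "z \<in> polydisc"
  shows "cmod (F z) \<le> 1"
proof -
  have hol: "mv_holomorphic_on F polydisc" and "bounded (F ` polydisc)"
    and AE: "AE \<zeta> in torus_measure. \<exists>l. ((\<lambda>r::real. F (r *\<^sub>R \<zeta>)) \<longlongrightarrow> l) (at_left 1) \<and> cmod l = 1"
    using F by (auto simp: inner_function_def Hinf_def)
  then obtain B where B: "\<And>z. z \<in> polydisc \<Longrightarrow> cmod (F z) \<le> B" unfolding bounded_iff by blast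
  have B0: "B \<ge> 0" using B[OF z] norm_ge_zero order_trans by blast
  define \<rho> where "\<rho> = Max (range (\<lambda>i. cmod (z $ i)))"
  have \<rho>: "cmod (z $ i) \<le> \<rho>" for i by (auto simp: \<rho>_def)
  have \<rho>1: "\<rho> < 1" using z by (auto simp: \<rho>_def polydisc_def)
  define C where "C = ennreal (1 / (2 * pi * (1 - \<rho>)))"
  let ?box = "cbox 0 (\<chi> i. 2 * pi) :: (real^'d) set"
  let ?T = "\<lambda>t::real^'d. \<chi> i. cis (t $ i)"
  define r :: "nat \<Rightarrow> real" where "r k = 1 - 1 / (real k + 2)" for k
  have r: "0 < r k" "r k < 1" for k by (auto simp: r_def field_simps)
  have r_lim: "r \<longlonglongrightarrow> 1" unfolding r_def by real_asymp
  then have r_at_left: "filterlim r (at_left 1) sequentially"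
    using r by (auto simp: filterlim_at less_imp_neq)
  have in_polydisc: "r k *\<^sub>R y \<in> polydisc" if "\<And>i. cmod (y $ i) \<le> 1" for k and y :: "complex^'d"
  proof -
    have "cmod (r k *\<^sub>R y $ i) < 1" for i
      using le_less_trans[OF mult_left_le[OF that[of i] less_imp_le[OF r(1)]] r(2)[of k]] r[of k] by simp
    then show ?thesis by (simp add: polydisc_def)
  qed
  define V where "V = emeasure lborel ?box"
  \<comment> \<open>The box has positive finite volume, so almost everywhere on the torus means
    almost everywhere in the box for Lebesgue measure.\<close>
  have AE_box: "AE t in lborel. t \<in> ?box \<longrightarrow> (\<lambda>k. cmod (F (r k *\<^sub>R ?T t))) \<longlonglongrightarrow> 1"
  proof -
    have pos: "(\<chi> i. 2 * pi :: real^'d) \<bullet> b > 0" if "b \<in> Basis" for b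
      using that by (auto simp: Basis_vec_def inner_axis)
    then have "emeasure lborel ?box = ennreal (\<Prod>b\<in>Basis. (\<chi> i. 2 * pi :: real^'d) \<bullet> b)"
      by (simp add: emeasure_lborel_cbox_eq less_imp_le)
    moreover have "(\<Prod>b\<in>Basis. (\<chi> i. 2 * pi :: real^'d) \<bullet> b) > 0" by (rule prod_pos) (rule pos)
    ultimately have "emeasure lborel ?box \<noteq> 0" by (metis ennreal_eq_0_iff not_le)
    moreover have "emeasure lborel ?box < \<infinity>" by (rule emeasure_lborel_cbox_finite)
    moreover have "AE t in uniform_measure lborel ?box. \<exists>l. ((\<lambda>r::real. F (r *\<^sub>R ?T t)) \<longlongrightarrow> l) (at_left 1) \<and> cmod l = 1"
    proof -
      have "?T \<in> measurable (uniform_measure lborel ?box) borel"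
        using measurable_torus_param by (simp add: measurable_def)
      from AE_distrD[OF this AE[unfolded torus_measure_def]] show ?thesis .
    qed
    ultimately have "AE t in lborel. t \<in> ?box \<longrightarrow> (\<exists>l. ((\<lambda>r::real. F (r *\<^sub>R ?T t)) \<longlongrightarrow> l) (at_left 1) \<and> cmod l = 1)"
      by (simp add: AE_uniform_measure)
    then show ?thesis
    proof (rule AE_mp, intro AE_I2 impI)
      fix t assume "t \<in> ?box \<longrightarrow> (\<exists>l. ((\<lambda>r::real. F (r *\<^sub>R ?T t)) \<longlongrightarrow> l) (at_left 1) \<and> cmod l = 1)" "t \<in> ?box"
      then obtain l where "((\<lambda>r::real. F (r *\<^sub>R ?T t)) \<longlongrightarrow> l) (at_left 1)" "cmod l = 1" by blast
      then show "(\<lambda>k. cmod (F (r k *\<^sub>R ?T t))) \<longlonglongrightarrow> 1"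
        using tendsto_norm[OF filterlim_compose[OF _ r_at_left]] by fastforce
    qed
  qed
  have bound: "ennreal (cmod (F z) ^ N) \<le> C ^ CARD('d) * V" for N
  proof -
    \<comment> \<open>Nothing is known about \<open>F\<close> outside the polydisc; the indicator
      makes the dilated function Borel on the whole space.\<close>
    define G where "G k y = indicator polydisc (r k *\<^sub>R y) * cmod (F (r k *\<^sub>R y)) ^ N" for k and y :: "complex^'d"
    have G_meas [measurable]: "G k \<in> borel_measurable borel" for k
    proof -
      have "(\<lambda>y. indicator polydisc y *\<^sub>R (cmod (F y) ^ N)) \<in> borel_measurable borel"
        by (intro borel_measurable_continuous_on_indicator continuous_intros
              mv_holomorphic_on_imp_continuous_on[OF hol] borel_open open_polydisc)
      from measurable_compose[OF _ this, of "\<lambda>y. r k *\<^sub>R y" borel]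
      show ?thesis by (simp add: G_def[abs_def])
    qed
    have G_eq: "G k y = cmod (F (r k *\<^sub>R y) ^ N)" if "\<And>i. cmod (y $ i) \<le> 1" for k y
      using in_polydisc[OF that] by (simp add: G_def norm_power)
    have G_bound: "G k y \<le> B ^ N" for k y
      using B[of "r k *\<^sub>R y"] B0 by (auto simp: G_def indicator_def intro: power_mono)
    have "ennreal (G k z) \<le> C ^ CARD('d) * (\<integral>\<^sup>+ t. ennreal (G k (?T t)) * indicator ?box t \<partial>lborel)" for k
    proof (rule torus_mean_bound[where \<rho> = \<rho>])
      fix y :: "complex^'d" and i assume y: "\<And>k. cmod (y $ k) \<le> 1" "cmod (y $ i) \<le> \<rho>"
      \<comment> \<open>Dilation by \<open>r k < 1\<close> makes the slice holomorphic on a disc of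
        radius \<open>1 / r k > 1\<close>, so Cauchy's formula is available on the unit
        circle.\<close>
      define g where "g x = F (r k *\<^sub>R vec_upd y i x) ^ N" for x
      have "(\<lambda>x. F (r k *\<^sub>R vec_upd y i x)) holomorphic_on ball 0 (1 / r k)"
      proof (rule mv_holomorphic_on_compose_curve[OF hol open_ball])
        show "(\<lambda>x. (r k *\<^sub>R vec_upd y i x) $ j) holomorphic_on ball 0 (1 / r k)" for j
          by (cases "j = i") (auto simp: scaleR_conv_of_real intro!: holomorphic_intros)
        fix x :: complex assume "x \<in> ball 0 (1 / r k)"
        moreover have "r k * cmod (y $ j) < 1" for j
          using le_less_trans[OF mult_left_le[OF y(1)[of j] less_imp_le[OF r(1)]] r(2)[of k]] .
        ultimately show "r k *\<^sub>R vec_upd y i x \<in> polydisc"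
          using r[of k] by (auto simp: polydisc_def field_simps)
      qed
      then have g: "g holomorphic_on ball 0 (1 / r k)" unfolding g_def by (intro holomorphic_intros)
      have "ennreal (G k y) = ennreal (cmod (g (y $ i)))" using G_eq[OF y(1)] by (simp add: g_def)
      also have "\<dots> \<le> ennreal (1 / (2 * pi * (1 - cmod (y $ i)))) *
          (\<integral>\<^sup>+ t. ennreal (cmod (g (cis t))) * indicator {0..2*pi} t \<partial>lborel)"
        by (rule Cauchy_mean_bound[OF g]) (use r[of k] y \<rho>1 in auto)
      also have "\<dots> \<le> C * (\<integral>\<^sup>+ t. ennreal (cmod (g (cis t))) * indicator {0..2*pi} t \<partial>lborel)"
        unfolding C_def using y(2) \<rho>1 by (intro mult_right_mono ennreal_leI divide_left_mono mult_left_mono mult_pos_pos) auto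
      also have "(\<integral>\<^sup>+ t. ennreal (cmod (g (cis t))) * indicator {0..2*pi} t \<partial>lborel) =
          (\<integral>\<^sup>+ t. ennreal (G k (vec_upd y i (cis t))) * indicator {0..2*pi} t \<partial>lborel)"
        using G_eq[of "vec_upd y i (cis _)" k] y(1) by (intro nn_integral_cong) (simp add: g_def)
      finally show "ennreal (G k y) \<le> C * (\<integral>\<^sup>+ t. ennreal (G k (vec_upd y i (cis t))) * indicator {0..2*pi} t \<partial>lborel)" .
    qed (use \<rho> \<rho>1 in auto)
    moreover have "(\<lambda>k. \<integral>\<^sup>+ t. ennreal (G k (?T t)) * indicator ?box t \<partial>lborel) \<longlonglongrightarrow> (\<integral>\<^sup>+ t. indicator ?box t \<partial>lborel)"
    \<comment> \<open>The radial limits have modulus 1 almost everywhere, and so have their N-th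
      powers; boundedness of \<open>F\<close> supplies the dominating constant
      \<open>B ^ N\<close>.\<close>
    proof (rule nn_integral_dominated_convergence[where w = "\<lambda>t. ennreal (B ^ N) * indicator ?box t"])
      have [measurable]: "?T \<in> borel_measurable borel" by (rule measurable_torus_param)
      show "(\<lambda>t. ennreal (G k (?T t)) * indicator ?box t) \<in> borel_measurable lborel" for k by measurable
      show "AE t in lborel. ennreal (G k (?T t)) * indicator ?box t \<le> ennreal (B ^ N) * indicator ?box t" for k
        by (intro AE_I2 mult_right_mono ennreal_leI G_bound) auto
      have "(\<integral>\<^sup>+ t. ennreal (B ^ N) * indicator ?box t \<partial>lborel) = ennreal (B ^ N) * emeasure lborel ?box"
        by (rule nn_integral_cmult_indicator) simp
      also have "\<dots> < \<infinity>" using emeasure_lborel_cbox_finite[of 0 "\<chi> i. 2 * pi :: real^'d"] by (simp add: ennreal_mult_less_top)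
      finally show "(\<integral>\<^sup>+ t. ennreal (B ^ N) * indicator ?box t \<partial>lborel) < \<infinity>" .
      show "AE t in lborel. (\<lambda>k. ennreal (G k (?T t)) * indicator ?box t) \<longlonglongrightarrow> indicator ?box t"
        using AE_box
      proof (rule AE_mp, intro AE_I2 impI)
        fix t assume *: "t \<in> ?box \<longrightarrow> (\<lambda>k. cmod (F (r k *\<^sub>R ?T t))) \<longlonglongrightarrow> 1"
        show "(\<lambda>k. ennreal (G k (?T t)) * indicator ?box t) \<longlonglongrightarrow> indicator ?box t"
        proof (cases "t \<in> ?box")
          case True
          then have "(\<lambda>k. ennreal (cmod (F (r k *\<^sub>R ?T t)) ^ N)) \<longlonglongrightarrow> ennreal (1 ^ N)"
            using * by (intro tendsto_ennrealI tendsto_power) auto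
          moreover have "G k (?T t) = cmod (F (r k *\<^sub>R ?T t)) ^ N" for k
            using G_eq[of "?T t" k] by (simp add: norm_power)
          ultimately show ?thesis using True by simp
        qed simp
      qed
    qed auto
    then have "(\<lambda>k. C ^ CARD('d) * (\<integral>\<^sup>+ t. ennreal (G k (?T t)) * indicator ?box t \<partial>lborel)) \<longlonglongrightarrow> C ^ CARD('d) * V"
      unfolding V_def by (intro ennreal_tendsto_cmult) (auto simp: C_def power_less_top_ennreal)
    moreover have "(\<lambda>k. ennreal (G k z)) \<longlonglongrightarrow> ennreal (cmod (F z) ^ N)"
    proof -
      have z1: "cmod (z $ i) \<le> 1" for i using \<rho>[of i] \<rho>1 by linarith
      have "(\<lambda>k. r k *\<^sub>R z) \<longlonglongrightarrow> 1 *\<^sub>R z" by (intro tendsto_intros r_lim)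
      then have "(\<lambda>k. F (r k *\<^sub>R z)) \<longlonglongrightarrow> F z"
        using continuous_on_tendsto_compose[OF mv_holomorphic_on_imp_continuous_on[OF hol], of "\<lambda>k. r k *\<^sub>R z" z]
          z in_polydisc[OF z1] by simp
      then have "(\<lambda>k. ennreal (cmod (F (r k *\<^sub>R z)) ^ N)) \<longlonglongrightarrow> ennreal (cmod (F z) ^ N)"
        by (intro tendsto_ennrealI tendsto_intros)
      then show ?thesis using G_eq[OF z1] by (simp add: norm_power)
    qed
    ultimately show ?thesis by (intro LIMSEQ_le) auto
  qed
  have "C ^ CARD('d) * V < \<infinity>"
    using emeasure_lborel_cbox_finite[of 0 "\<chi> i. 2 * pi :: real^'d"]
    by (auto simp: V_def C_def ennreal_mult_less_top power_less_top_ennreal)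
  then obtain K where K: "C ^ CARD('d) * V = ennreal K" "K \<ge> 0" by (metis ennreal_cases infinity_ennreal_def less_irrefl)
  have le: "cmod (F z) ^ N \<le> K" for N using bound[of N] K by simp
  show ?thesis
  proof (rule ccontr)
    assume "\<not> cmod (F z) \<le> 1"
    then obtain N where "K < cmod (F z) ^ N" using real_arch_pow[of "cmod (F z)" K] by auto
    with le[of N] show False by simp
  qed
qed

section \<open>Rational inner functions\<close>

text \<open>The one-variable maximum principle moves the coordinates to the circle one at a time;
  the induction set \<open>A\<close> holds those that may still lie inside the disc.\<close>

lemma poly_fun_maximum_modulus:
  fixes P :: "complex^'d \<Rightarrow> complex"
  assumes P: "poly_fun P" and torus: "\<And>z. (\<And>i. cmod (z $ i) = 1) \<Longrightarrow> cmod (P z) \<le> B"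
    and z: "\<And>i. cmod (z $ i) \<le> 1"
  shows "cmod (P z) \<le> B"
proof -
  have "cmod (P z) \<le> B" if "\<And>i. cmod (z $ i) \<le> 1" "\<And>i. i \<notin> A \<Longrightarrow> cmod (z $ i) = 1" for A z
    using finite[of A] that
  proof (induction A arbitrary: z rule: finite_induct)
    case empty
    then show ?case using torus by simp
  next
    case (insert j A)
    have hol: "(\<lambda>x. P (vec_upd z j x)) holomorphic_on UNIV"
    proof (rule poly_fun_holomorphic_curve[OF P])
      show "(\<lambda>x. vec_upd z j x $ i) holomorphic_on UNIV" for i
        by (cases "i = j") (auto intro!: holomorphic_intros)
    qed
    have "cmod (P (vec_upd z j (z $ j))) \<le> B"
    proof (rule maximum_modulus_frontier[where S = "cball 0 1" and f = "\<lambda>x. P (vec_upd z j x)"])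
      show "(\<lambda>x. P (vec_upd z j x)) holomorphic_on interior (cball 0 1)"
        using hol holomorphic_on_subset by blast
      show "continuous_on (closure (cball 0 1)) (\<lambda>x. P (vec_upd z j x))"
        using hol holomorphic_on_imp_continuous_on continuous_on_subset by blast
      fix x assume "x \<in> frontier (cball (0::complex) 1)"
      then have "cmod x = 1" by simp
      then show "cmod (P (vec_upd z j x)) \<le> B"
        by (intro insert.IH) (use insert.prems in auto)
    qed (use insert.prems in auto)
    then show ?case by simp
  qed
  from this[of z UNIV] z show ?thesis by simp
qed

section \<open>Conjugation on the torus and Rudin's quotients\<close>

lemma basic_map_last_norm:
  assumes "\<And>i. cmod (z $ i) = 1"
  shows "cmod (basic_map m n z $ (last_idx :: 'd::{finite,linorder})) = 1"
  by (simp add: basic_map_nth norm_power assms flip: prod_norm)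

text \<open>On the torus complex conjugation amounts to inversion, so conjugating \<open>basic_map\<close> there
  exchanges the elementary symmetric polynomials of degrees \<open>j\<close> and \<open>d - j\<close> up to a power of
  the last coordinate.\<close>

lemma poly_fun_reflect:
  fixes p :: "complex^('d::{finite,linorder}) \<Rightarrow> complex"
  assumes "n dvd m" "poly_fun p"
  shows "\<exists>K q. poly_fun q \<and> (\<forall>z. (\<forall>i. cmod (z $ i) = 1) \<longrightarrow>
    q (basic_map m n z) = (basic_map m n z $ last_idx) ^ K * cnj (p (basic_map m n z)))"
  using assms(2)
proof (induction rule: poly_fun.induct)
  case (poly_fun_const c)
  show ?case by (rule exI[of _ 0], rule exI[of _ "\<lambda>_. cnj c"]) (auto intro: poly_fun.intros)
next
  case (poly_fun_nth i)
  show ?case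
  proof (cases "i = last_idx")
    case True
    have "basic_map m n z $ i * cnj (basic_map m n z $ i) = 1" if "\<forall>i. cmod (z $ i) = 1" for z :: "complex^('d::{finite,linorder})"
      using basic_map_last_norm[of z m n] that True by (simp add: complex_norm_square[symmetric])
    \<comment> \<open>The last coordinate is unimodular on the torus, so its conjugate times itself
      is the constant polynomial 1.\<close>
    with True show ?thesis
      by (intro exI[of _ 1] exI[of _ "\<lambda>_. 1"]) (auto intro: poly_fun.intros)
  next
    case False
    define j where "j = coord_rank i"
    have j: "1 \<le> j" "j < CARD('d)" using False coord_rank_bounds[of i] coord_rank_less_iff[of i] by (auto simp: j_def)
    then have "1 \<le> CARD('d) - j" "CARD('d) - j \<le> CARD('d)" by auto
    then obtain i' :: 'd where i': "coord_rank i' = CARD('d) - j" by (rule coord_rank_obtain)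
    have "i' \<noteq> last_idx" using i' j coord_rank_less_iff[of i'] by simp
    \<comment> \<open>The exponent \<open>n\<close> arises because passing to complementary subsets
      costs the full product of the z_k^m, which is the n-th power of the last coordinate.\<close>
    have "basic_map m n z $ i' = (basic_map m n z $ last_idx) ^ n * cnj (basic_map m n z $ i)"
      if "\<forall>i. cmod (z $ i) = 1" for z :: "complex^('d::{finite,linorder})"
    proof -
      have nz: "z $ k ^ m \<noteq> 0" for k using that by (metis norm_zero power_not_zero zero_neq_one)
      have "cnj (z $ k ^ m) = inverse (z $ k ^ m)" for k
        by (rule inverse_unique[symmetric], unfold complex_norm_square[symmetric]) (use that in \<open>simp add: norm_power\<close>)
      then have "cnj (basic_map m n z $ i) = elem_sym j (\<lambda>k. inverse (z $ k ^ m))"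
        using False by (simp add: basic_map_nth elem_sym_def j_def)
      moreover have "basic_map m n z $ i' = elem_sym (CARD('d) - j) (\<lambda>k. z $ k ^ m)"
        using \<open>i' \<noteq> last_idx\<close> by (simp add: basic_map_nth i')
      ultimately show ?thesis
        using elem_sym_inverse[of "\<lambda>k. z $ k ^ m" j] nz j basic_map_last_power[OF assms(1), of z]
        by (simp add: elem_sym_card mult.commute)
    qed
    then show ?thesis
      by (intro exI[of _ n] exI[of _ "\<lambda>z. z $ i'"]) (auto intro: poly_fun.intros)
  qed
next
  case (poly_fun_add p1 p2)
  then obtain K1 q1 K2 q2 where q: "poly_fun q1" "poly_fun q2"
    "\<And>z. (\<forall>i. cmod (z $ i) = 1) \<Longrightarrow> q1 (basic_map m n z) = (basic_map m n z $ last_idx) ^ K1 * cnj (p1 (basic_map m n z))"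
    "\<And>z. (\<forall>i. cmod (z $ i) = 1) \<Longrightarrow> q2 (basic_map m n z) = (basic_map m n z $ last_idx) ^ K2 * cnj (p2 (basic_map m n z))"
    by blast
  \<comment> \<open>The two exponents may differ, so each summand is multiplied by the other's power
    of the last coordinate.\<close>
  show ?case
    by (intro exI[of _ "K1 + K2"] exI[of _ "\<lambda>z. q1 z * z $ last_idx ^ K2 + q2 z * z $ last_idx ^ K1"])
      (auto simp: q(3,4) algebra_simps power_add intro!: poly_fun_intros q)
next
  case (poly_fun_mult p1 p2)
  then obtain K1 q1 K2 q2 where q: "poly_fun q1" "poly_fun q2"
    "\<And>z. (\<forall>i. cmod (z $ i) = 1) \<Longrightarrow> q1 (basic_map m n z) = (basic_map m n z $ last_idx) ^ K1 * cnj (p1 (basic_map m n z))"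
    "\<And>z. (\<forall>i. cmod (z $ i) = 1) \<Longrightarrow> q2 (basic_map m n z) = (basic_map m n z $ last_idx) ^ K2 * cnj (p2 (basic_map m n z))"
    by blast
  show ?case
    by (intro exI[of _ "K1 + K2"] exI[of _ "\<lambda>z. q1 z * q2 z"])
      (auto simp: q(3,4) algebra_simps power_add intro!: poly_fun_intros q)
qed

lemma AE_torus_measure: "AE \<zeta> in (torus_measure :: (complex^'d) measure). \<forall>i. cmod (\<zeta> $ i) = 1"
proof -
  have "closed {\<zeta>::complex^'d. \<forall>i. cmod (\<zeta> $ i) = 1}"
    by (intro closed_Collect_all closed_Collect_eq continuous_intros)
  then have "{\<zeta> \<in> space borel. \<forall>i. cmod (\<zeta>$i) = 1} \<in> sets (borel :: (complex^'d) measure)"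
    by (simp add: borel_closed)
  moreover have "(\<lambda>t::real^'d. \<chi> i. cis (t $ i)) \<in> measurable (uniform_measure lborel (cbox 0 (\<chi> i. 2 * pi))) borel"
    using measurable_torus_param by (simp add: measurable_def)
  ultimately show ?thesis
    unfolding torus_measure_def by (subst AE_distr_iff) auto
qed

lemma polydisc_bound_closure:
  fixes G :: "complex^'d \<Rightarrow> complex"
  assumes "continuous_on UNIV G" "\<And>z. z \<in> polydisc \<Longrightarrow> cmod (G z) \<le> B" "\<And>i. cmod (z $ i) \<le> 1"
  shows "cmod (G z) \<le> B"
proof -
  define r :: "nat \<Rightarrow> real" where "r k = 1 - 1 / (real k + 2)" for k
  have r: "0 < r k" "r k < 1" for k by (auto simp: r_def field_simps)
  have r_lim: "r \<longlonglongrightarrow> 1" unfolding r_def by real_asymp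
  have "r k *\<^sub>R z \<in> polydisc" for k
    using le_less_trans[OF mult_left_le[OF assms(3) less_imp_le[OF r(1)]] r(2)[of k]] r[of k]
    by (simp add: polydisc_def)
  then have "cmod (G (r k *\<^sub>R z)) \<le> B" for k using assms(2) by blast
  moreover have "(\<lambda>k. r k *\<^sub>R z) \<longlonglongrightarrow> 1 *\<^sub>R z" by (intro tendsto_intros r_lim)
  then have "(\<lambda>k. cmod (G (r k *\<^sub>R z))) \<longlonglongrightarrow> cmod (G z)"
    by (intro tendsto_norm continuous_on_tendsto_compose[OF assms(1)]) auto
  ultimately show ?thesis by (intro LIMSEQ_le_const2) auto
qed

lemma basic_map_last_norm_le:
  assumes "\<And>i. cmod (z $ i) \<le> 1"
  shows "cmod (basic_map m n z $ (last_idx :: 'd::{finite,linorder})) \<le> 1"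
  using assms by (simp add: basic_map_nth norm_power power_le_one prod_nonneg prod_le_1 flip: prod_norm)

lemma basic_map_last_norm_less:
  assumes "z \<in> polydisc" "m > 0" "n dvd m"
  shows "cmod (basic_map m n z $ (last_idx :: 'd::{finite,linorder})) < 1"
proof -
  have "(\<Prod>k\<in>(UNIV::'d set). cmod (z $ k)) \<le> (\<Prod>k\<in>(UNIV::'d set). if k = last_idx then cmod (z $ k) else 1)"
    using assms(1) by (intro prod_mono) (auto simp: polydisc_def less_imp_le)
  also have "\<dots> < 1" using assms(1) by (simp add: polydisc_def)
  finally have "cmod (\<Prod>k\<in>(UNIV::'d set). z $ k) < 1" by (simp add: prod_norm)
  moreover have "m div n > 0" using assms(2,3) by (metis dvd_div_eq_0_iff not_gr0)
  ultimately show ?thesis by (simp add: basic_map_nth norm_power power_less_one_iff)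
qed

text \<open>Rudin's construction of rational inner functions: the quotient below is \<open>(p + u) / (1 + u cnj p)\<close>
  with \<open>u\<close> unimodular on the torus.\<close>

lemma inner_approx_poly_fun:
  fixes p :: "complex^('d::{finite,linorder}) \<Rightarrow> complex"
  assumes mn: "m > 0" "n > 0" "n dvd m" and p: "poly_fun p"
    and b: "\<And>w. w \<in> basic_map m n ` polydisc \<Longrightarrow> cmod (p w) \<le> \<rho>" and \<rho>: "\<rho> < 1"
  obtains f where "\<And>k. f k \<in> inner_on_image m n"
    "\<And>w. w \<in> basic_map m n ` polydisc \<Longrightarrow> (\<lambda>k. f k w) \<longlonglongrightarrow> p w"
proof -
  let ?\<Omega> = "basic_map m n ` (polydisc :: (complex^('d::{finite,linorder})) set)"
  obtain K q where q: "poly_fun q" and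
    q_torus: "\<And>z. (\<forall>i. cmod (z $ i) = 1) \<Longrightarrow> q (basic_map m n z) = (basic_map m n z $ last_idx) ^ K * cnj (p (basic_map m n z))"
    using poly_fun_reflect[OF mn(3) p] by blast
  have pb: "cmod (p (basic_map m n z)) \<le> \<rho>" if "\<And>i. cmod (z $ i) \<le> 1" for z
    by (rule polydisc_bound_closure[where G = "\<lambda>z. p (basic_map m n z)"])
      (use b that in \<open>auto intro!: poly_fun_continuous poly_fun_compose[OF p] poly_fun_basic_map\<close>)
  \<comment> \<open>On the torus this product has the modulus of \<open>p\<close>; the maximum
    principle carries the bound inward, uniformly in \<open>M\<close>, and thereby keeps the
    denominators away from 0.\<close>
  have qb: "cmod ((basic_map m n z $ last_idx) ^ M * q (basic_map m n z)) \<le> \<rho>"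
    if "\<And>i. cmod (z $ i) \<le> 1" for M z
  proof (rule poly_fun_maximum_modulus[where P = "\<lambda>z. (basic_map m n z $ last_idx) ^ M * q (basic_map m n z)"])
    show "poly_fun (\<lambda>z::complex^('d::{finite,linorder}). basic_map m n z $ last_idx ^ M * q (basic_map m n z))"
      by (intro poly_fun_intros poly_fun_compose[OF q] poly_fun_basic_map)
    show "cmod (basic_map m n z $ last_idx ^ M * q (basic_map m n z)) \<le> \<rho>" if "\<And>i. cmod (z $ i) = 1" for z :: "complex^('d::{finite,linorder})"
      using that pb[of z] by (simp add: q_torus norm_mult norm_power basic_map_last_norm)
  qed (rule that)
  \<comment> \<open>With \<open>u\<close> the power \<open>K + M\<close> of the last coordinate, the
    term \<open>(w $ last_idx) ^ M * q w\<close> of the denominator equals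
    \<open>u * cnj (p w)\<close> over the torus, since \<open>q\<close> already contains the power
    \<open>K\<close>.\<close>
  define num where "num M w = p w + (w $ last_idx) ^ (K + M)" for M and w :: "complex^('d::{finite,linorder})"
  define den where "den M w = 1 + (w $ last_idx) ^ M * q w" for M and w :: "complex^('d::{finite,linorder})"
  have num_poly: "poly_fun (num M)" and den_poly: "poly_fun (den M)" for M
    unfolding num_def[abs_def] den_def[abs_def] by (intro poly_fun_intros p q)+
  have den_bound: "cmod (den M (basic_map m n z)) \<ge> 1 - \<rho>" if "\<And>i. cmod (z $ i) \<le> 1" for M z
    using qb[OF that, of M] norm_diff_ineq[of 1 "(basic_map m n z $ last_idx) ^ M * q (basic_map m n z)"]
    by (simp add: den_def)
  have num_bound: "cmod (num M (basic_map m n z)) \<le> 2" if "\<And>i. cmod (z $ i) \<le> 1" for M z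
    using pb[OF that] \<rho> norm_triangle_ineq[of "p (basic_map m n z)" "(basic_map m n z $ last_idx) ^ (K + M)"]
      power_le_one[OF norm_ge_zero basic_map_last_norm_le[OF that, of m n], of "K + M"]
    by (simp add: num_def norm_power)
  define f where "f M w = num M w / den M w" for M w
  have f_bound: "cmod (f M (basic_map m n z)) \<le> 2 / (1 - \<rho>)" if "\<And>i. cmod (z $ i) \<le> 1" for M z
    unfolding f_def norm_divide using num_bound[OF that, of M] den_bound[OF that, of M] \<rho>
    by (intro frac_le) auto
  have pd: "cmod (z $ i) \<le> 1" if "z \<in> polydisc" for z :: "complex^('d::{finite,linorder})" and i
    using that by (simp add: polydisc_def less_imp_le)
  have den_nz: "den M (basic_map m n z) \<noteq> 0" if "\<And>i. cmod (z $ i) \<le> 1" for M z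
    using den_bound[OF that, of M] \<rho> by auto
  have "f M \<in> inner_on_image m n" for M
  proof -
    have "f M \<in> Hinf ?\<Omega>"
      unfolding Hinf_def f_def[abs_def] bounded_iff
      using mv_holomorphic_on_divide[OF mv_holomorphic_on_poly_fun[OF num_poly] mv_holomorphic_on_poly_fun[OF den_poly], of ?\<Omega> M M]
        den_nz[OF pd] f_bound[OF pd, of _ M] by (auto simp: f_def)
    moreover have "f M \<circ> basic_map m n \<in> Hinf polydisc"
    proof -
      have "mv_holomorphic_on (\<lambda>z. num M (basic_map m n z) / den M (basic_map m n z)) polydisc"
        by (intro mv_holomorphic_on_divide mv_holomorphic_on_poly_fun poly_fun_compose[OF num_poly]
            poly_fun_compose[OF den_poly] poly_fun_basic_map den_nz pd)
      then show ?thesis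
        unfolding Hinf_def bounded_iff o_def using f_bound[OF pd, of _ M] by (auto simp: f_def)
    qed
    moreover have "AE \<zeta> in torus_measure. \<exists>l. ((\<lambda>r::real. (f M \<circ> basic_map m n) (r *\<^sub>R \<zeta>)) \<longlongrightarrow> l) (at_left 1) \<and> cmod l = 1"
      using AE_torus_measure
    proof (rule AE_mp, intro AE_I2 impI)
      fix \<zeta> :: "complex^('d::{finite,linorder})" assume \<zeta>: "\<forall>i. cmod (\<zeta> $ i) = 1"
      let ?w = "basic_map m n \<zeta>"
      define u where "u = ?w $ last_idx ^ (K + M)"
      have u: "cmod u = 1" using basic_map_last_norm[of \<zeta> m n] \<zeta> by (simp add: u_def norm_power)
      have den: "den M ?w = 1 + u * cnj (p ?w)"
        using q_torus[OF \<zeta>] by (simp add: den_def u_def power_add)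
      \<comment> \<open>Uses \<open>u * cnj u = 1\<close>: numerator and denominator have equal
        modulus on the torus.\<close>
      have "num M ?w = u * cnj (den M ?w)"
        using u by (simp add: num_def den u_def[symmetric] distrib_left complex_norm_square[symmetric] mult.assoc[symmetric])
      then have "cmod (f M ?w) = 1"
        using u den_nz[of \<zeta> M] \<zeta> by (simp add: f_def norm_divide norm_mult)
      moreover have "((\<lambda>r::real. f M (basic_map m n (r *\<^sub>R \<zeta>))) \<longlongrightarrow> f M (basic_map m n (1 *\<^sub>R \<zeta>))) (at_left 1)"
      proof -
        have *: "((\<lambda>r::real. g (basic_map m n (r *\<^sub>R \<zeta>))) \<longlongrightarrow> g (basic_map m n (1 *\<^sub>R \<zeta>))) (at_left 1)"
          if "poly_fun g" for g :: "complex^('d::{finite,linorder}) \<Rightarrow> complex"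
        proof -
          have "((\<lambda>r::real. r *\<^sub>R \<zeta>) \<longlongrightarrow> 1 *\<^sub>R \<zeta>) (at_left 1)" by (intro tendsto_intros)
          from continuous_on_tendsto_compose[OF poly_fun_continuous[OF poly_fun_compose[OF that poly_fun_basic_map], of UNIV] this]
          show ?thesis by simp
        qed
        show ?thesis unfolding f_def
          by (rule tendsto_divide[OF *[OF num_poly] *[OF den_poly]]) (use den_nz[of \<zeta> M] \<zeta> in simp)
      qed
      ultimately show "\<exists>l. ((\<lambda>r::real. (f M \<circ> basic_map m n) (r *\<^sub>R \<zeta>)) \<longlongrightarrow> l) (at_left 1) \<and> cmod l = 1"
        by auto
    qed
    ultimately show ?thesis by (simp add: inner_on_image_def inner_function_def)
  qed
  moreover have "(\<lambda>M. f M w) \<longlonglongrightarrow> p w" if "w \<in> ?\<Omega>" for w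
  proof -
    have "cmod (w $ last_idx) < 1" using that basic_map_last_norm_less[OF _ mn(1,3)] by auto
    then have pow: "(\<lambda>M. (w $ last_idx) ^ M) \<longlonglongrightarrow> 0" by (rule LIMSEQ_power_zero)
    have "(\<lambda>M. (p w + (w $ last_idx) ^ K * (w $ last_idx) ^ M) / (1 + (w $ last_idx) ^ M * q w))
        \<longlonglongrightarrow> (p w + (w $ last_idx) ^ K * 0) / (1 + 0 * q w)"
      by (intro tendsto_intros pow) simp
    then show ?thesis by (simp add: f_def num_def den_def power_add)
  qed
  ultimately show thesis using that by blast
qed

section \<open>Approximation of Schur functions by polynomials\<close>

text \<open>Lagrange interpolation: both sides have degree at most \<open>k\<close> and agree at the
  \<open>k + 1\<close> nodes 0, ..., k. It replaces unknown coefficients by values of the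
  function.\<close>

lemma polynomial_interpolation:
  fixes g :: "complex \<Rightarrow> complex"
  assumes g: "\<And>x. g x = (\<Sum>i\<le>k. c i * x ^ i)"
  shows "g x = (\<Sum>l\<le>k. g (of_nat l) * (\<Prod>t\<in>{..k}-{l}. (x - of_nat t) * (1 / (of_nat l - of_nat t))))"
proof -
  define P where "P = (\<Sum>i\<le>k. monom (c i) i)"
  define Q where "Q = (\<Sum>l\<le>k. smult (g (of_nat l)) (\<Prod>t\<in>{..k}-{l}. smult (1 / (of_nat l - of_nat t)) [:- of_nat t, 1:]))"
  have P: "poly P x = g x" for x by (simp add: P_def poly_sum poly_monom g)
  have Q: "poly Q x = (\<Sum>l\<le>k. g (of_nat l) * (\<Prod>t\<in>{..k}-{l}. (x - of_nat t) * (1 / (of_nat l - of_nat t))))" for x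
    by (simp add: Q_def poly_sum poly_prod diff_divide_distrib)
  have "P = Q"
  proof (rule poly_eqI_degree[where A = "of_nat ` {..k}"])
    fix x :: complex assume "x \<in> of_nat ` {..k}"
    then obtain j where j: "x = of_nat j" "j \<le> k" by auto
    have "poly Q x = (\<Sum>l\<le>k. if l = j then g (of_nat j) else 0)"
      unfolding Q
    proof (intro sum.cong refl)
      fix l assume l: "l \<in> {..k}"
      show "g (of_nat l) * (\<Prod>t\<in>{..k}-{l}. (x - of_nat t) * (1 / (of_nat l - of_nat t))) = (if l = j then g (of_nat j) else 0)"
      proof (cases "l = j")
        case True
        have "(\<Prod>t\<in>{..k}-{j}. (of_nat j - of_nat t) * (1 / (of_nat j - of_nat t)) :: complex) = 1"
          by (rule prod.neutral) auto
        then show ?thesis using True j by simp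
      next
        case False
        then have "(\<Prod>t\<in>{..k}-{l}. (x - of_nat t) * (1 / (of_nat l - of_nat t))) = 0"
          using j by (intro prod_zero bexI[of _ j]) auto
        then show ?thesis using False by simp
      qed
    qed
    then show "poly P x = poly Q x" using j by (simp add: P)
  next
    have card: "card (of_nat ` {..k} :: complex set) = Suc k"
      by (subst card_image) (auto simp: inj_on_def)
    have "degree P \<le> k" unfolding P_def
      by (rule degree_sum_le) (auto intro: order.trans[OF degree_monom_le])
    then show "card (of_nat ` {..k} :: complex set) > degree P" using card by simp
    have "degree Q \<le> k" unfolding Q_def
    proof (rule degree_sum_le)
      fix l assume l: "l \<in> {..k}"
      have "degree (\<Prod>t\<in>{..k}-{l}. smult (1 / (of_nat l - of_nat t)) [:- of_nat t, 1::complex:]) \<le>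
          (\<Sum>t\<in>{..k}-{l}. degree (smult (1 / (of_nat l - of_nat t)) [:- of_nat t, 1::complex:]))"
        by (rule order_trans[OF degree_prod_sum_le]) (simp_all only: o_def finite_Diff finite_atMost order_refl)
      also have "\<dots> \<le> (\<Sum>t\<in>{..k}-{l}. 1)"
        by (intro sum_mono order_trans[OF degree_smult_le]) simp
      also have "\<dots> = k" using l by simp
      finally show "degree (smult (g (of_nat l)) (\<Prod>t\<in>{..k}-{l}. smult (1 / (of_nat l - of_nat t)) [:- of_nat t, 1:])) \<le> k"
        using degree_smult_le order_trans by blast
    qed simp
    then show "card (of_nat ` {..k} :: complex set) > degree Q" using card by simp
  qed
  then show ?thesis using P Q by metis
qed

text \<open>The coefficients \<open>c\<close> may depend on the other coordinates in an unknown way.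
  Interpolation in one coordinate, possible because the degree bound \<open>k\<close> is uniform,
  expresses \<open>H\<close> through its values at integer points there, and by induction these are
  polynomials in the coordinates already freed.\<close>

lemma poly_fun_if_separately_polynomial:
  fixes H :: "complex^'d \<Rightarrow> complex"
  assumes "\<And>z i. \<exists>c. \<forall>x. H (vec_upd z i x) = (\<Sum>j\<le>k. c j * x ^ j)"
  shows "poly_fun H"
proof -
  define mix where "mix A z z0 = (\<chi> i. if i \<in> A then z $ i else z0 $ i)" for A and z z0 :: "complex^'d"
  have "poly_fun (\<lambda>z. H (mix A z z0))" for A z0
  proof (induction A arbitrary: z0 rule: finite_induct[OF finite])
    case 1
    have "mix {} z z0 = z0" for z by (simp add: mix_def vec_eq_iff)
    then show ?case by (simp add: poly_fun_const)
  next
    case (2 j A)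
    have "H (mix (insert j A) z z0) = (\<Sum>l\<le>k. H (mix A z (vec_upd z0 j (of_nat l))) *
        (\<Prod>t\<in>{..k}-{l}. (z $ j - of_nat t) * (1 / (of_nat l - of_nat t))))" for z
    proof -
      have eq: "vec_upd (mix A z z0) j (of_nat l) = mix A z (vec_upd z0 j (of_nat l))" for l
        by (rule vec_eq_iff[THEN iffD2]) (use 2(2) in \<open>auto simp: mix_def\<close>)
      have eq': "mix (insert j A) z z0 = vec_upd (mix A z z0) j (z $ j)"
        by (rule vec_eq_iff[THEN iffD2]) (auto simp: mix_def)
      obtain c where c: "\<And>x. H (vec_upd (mix A z z0) j x) = (\<Sum>i\<le>k. c i * x ^ i)" using assms by metis
      show ?thesis
        using polynomial_interpolation[of "\<lambda>x. H (vec_upd (mix A z z0) j x)", OF c, of "z $ j"]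
        unfolding eq eq' .
    qed
    then show ?case by (simp only:) (intro poly_fun_intros 2(3))
  qed
  from this[of UNIV 0] show ?thesis by (simp add: mix_def)
qed

section \<open>Cauchy estimates for Taylor coefficients and tails of power series\<close>

lemma Taylor_coeff_bound:
  assumes g: "g holomorphic_on ball 0 R" and b: "\<And>x. x \<in> ball 0 R \<Longrightarrow> cmod (g x) \<le> 1" and r: "0 < r" "r < R"
  shows "cmod ((deriv ^^ k) g 0 / fact k) \<le> 1 / r ^ k"
proof -
  have sub: "cball 0 r \<subseteq> ball (0::complex) R" using r by auto
  have "cmod ((deriv ^^ k) g 0) \<le> fact k * 1 / r ^ k"
  proof (rule Cauchy_inequality)
    show "g holomorphic_on ball 0 r" using sub g holomorphic_on_subset ball_subset_cball by blast
    show "continuous_on (cball 0 r) g" using sub g holomorphic_on_subset holomorphic_on_imp_continuous_on by blast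
    show "cmod (g x) \<le> 1" if "cmod (0 - x) = r" for x
      by (rule b) (use that r in auto)
  qed (use r in simp)
  then show ?thesis by (simp add: norm_divide field_simps)
qed

lemma power_series_tail_bound:
  fixes a :: "nat \<Rightarrow> complex"
  assumes a: "(\<lambda>l. a l * x ^ l) sums G" "\<And>l. cmod (a l) \<le> 1 / S ^ l" and x: "S > 0" "cmod x < S"
  shows "cmod (G - (\<Sum>l<K. a l * x ^ l)) \<le> (cmod x / S) ^ K / (1 - cmod x / S)"
proof -
  let ?q = "cmod x / S"
  have q: "0 \<le> ?q" "?q < 1" using x by auto
  have "(\<lambda>l. a (l + K) * x ^ (l + K)) sums (G - (\<Sum>l<K. a l * x ^ l))"
    using a(1) by (rule sums_split_initial_segment)
  moreover have geo: "(\<lambda>l. ?q ^ K * ?q ^ l) sums (?q ^ K * (1 / (1 - ?q)))"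
    by (intro sums_mult geometric_sums) (use q in auto)
  moreover have "cmod (a (l + K) * x ^ (l + K)) \<le> ?q ^ K * ?q ^ l" for l
    using mult_right_mono[OF a(2)[of "l + K"], of "cmod x ^ (l + K)"]
    by (simp add: norm_mult norm_power power_divide power_add field_simps)
  ultimately show ?thesis
    using norm_sums_le by fastforce
qed

text \<open>The degree of the i-th basic polynomial as a homogeneous polynomial in z.\<close>

definition weight :: "nat \<Rightarrow> nat \<Rightarrow> 'd::{finite,linorder} \<Rightarrow> nat" where
  "weight m n i = (if i \<noteq> last_idx then m * coord_rank i else m div n * CARD('d))"

definition dilate :: "nat \<Rightarrow> nat \<Rightarrow> complex \<Rightarrow> complex^('d::{finite,linorder}) \<Rightarrow> complex^('d::{finite,linorder})" where
  "dilate m n s w = (\<chi> i. s ^ weight m n i * w $ i)"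

lemma weight_pos: "m > 0 \<Longrightarrow> n dvd m \<Longrightarrow> weight m n i > 0"
  using coord_rank_bounds[of i] by (auto simp: weight_def dvd_div_eq_0_iff)

lemma basic_map_scale: "basic_map m n (s *s z) = dilate m n s (basic_map m n z)"
proof -
  have "elem_sym j (\<lambda>k. s ^ m * z $ k ^ m) = s ^ (m * j) * elem_sym j (\<lambda>k. z $ k ^ m)" for j
    unfolding elem_sym_def sum_distrib_left
    by (intro sum.cong) (auto simp: prod.distrib power_mult)
  moreover have "(\<Prod>k\<in>(UNIV::'a set). s * z $ k) ^ (m div n) = s ^ (m div n * CARD('a)) * (\<Prod>k\<in>UNIV. z $ k) ^ (m div n)"
    by (simp add: prod.distrib power_mult_distrib power_mult mult.commute)
  ultimately show ?thesis
    by (simp add: vec_eq_iff basic_map_nth dilate_def weight_def power_mult_distrib)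
qed

lemma dilate_1 [simp]: "dilate m n 1 w = w"
  by (simp add: dilate_def vec_eq_iff)

lemma zero_in_basic_map_image:
  assumes "m > 0" "n dvd m"
  shows "0 \<in> basic_map m n ` (polydisc :: (complex^('d::{finite,linorder})) set)"
proof -
  have "basic_map m n (0 *s 0) = (0 :: complex^('d::{finite,linorder}))"
    unfolding basic_map_scale by (simp add: dilate_def vec_eq_iff weight_pos[OF assms])
  moreover have "0 *s 0 \<in> (polydisc :: (complex^('d::{finite,linorder})) set)" by (simp add: polydisc_def)
  ultimately show ?thesis by (metis image_eqI)
qed

text \<open>The weighted homogeneous components of \<open>\<phi>\<close>. The defining function of \<open>s\<close> is holomorphic near
  \<open>0\<close> for every \<open>w\<close>, so the components are defined on the whole space.\<close>

definition hom_part :: "nat \<Rightarrow> nat \<Rightarrow> (complex^('d::{finite,linorder}) \<Rightarrow> complex) \<Rightarrow> nat \<Rightarrow> complex^('d::{finite,linorder}) \<Rightarrow> complex" where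
  "hom_part m n \<phi> k w = (deriv ^^ k) (\<lambda>s. \<phi> (dilate m n s w)) 0 / fact k"

text \<open>Dilating \<open>w\<close> inside the image amounts to scaling a preimage, and a point of
  the polydisc can be scaled by slightly more than 1. So the series converges at
  \<open>s = 1\<close> as well, and Cauchy's estimate on the unit circle bounds each component by
  1.\<close>

lemma hom_part_in_image:
  fixes \<phi> :: "complex^('d::{finite,linorder}) \<Rightarrow> complex"
  assumes \<phi>: "mv_holomorphic_on \<phi> (basic_map m n ` polydisc)"
      "\<And>w. w \<in> basic_map m n ` polydisc \<Longrightarrow> cmod (\<phi> w) \<le> 1"
    and w: "w \<in> basic_map m n ` polydisc"
  obtains R where "R > 1" "(\<lambda>s. \<phi> (dilate m n s w)) holomorphic_on ball 0 R"
    "\<And>k. cmod (hom_part m n \<phi> k w) \<le> 1"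
    "\<And>s. s \<in> ball 0 R \<Longrightarrow> dilate m n s w \<in> basic_map m n ` polydisc"
    "\<And>s. s \<in> ball 0 R \<Longrightarrow> (\<lambda>k. hom_part m n \<phi> k w * s ^ k) sums \<phi> (dilate m n s w)"
proof -
  obtain z where z: "z \<in> polydisc" "w = basic_map m n z" using w by auto
  define \<mu> where "\<mu> = Max (range (\<lambda>i. cmod (z $ i)))"
  have \<mu>: "cmod (z $ i) \<le> \<mu>" for i by (auto simp: \<mu>_def)
  have \<mu>1: "\<mu> < 1" using z by (auto simp: \<mu>_def polydisc_def)
  have \<mu>0: "\<mu> \<ge> 0" using \<mu> norm_ge_zero order_trans by blast
  \<comment> \<open>Chosen so that both \<open>R > 1\<close> and \<open>R * \<mu> < 1\<close> follow
    from \<open>0 \<le> \<mu> < 1\<close>.\<close>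
  define R where "R = 2 / (1 + \<mu>)"
  have R1: "R > 1" and R\<mu>: "R * \<mu> < 1" using \<mu>1 \<mu>0 by (auto simp: R_def field_simps)
  have mem: "dilate m n s w \<in> basic_map m n ` polydisc" if "s \<in> ball 0 R" for s
  proof -
    have "cmod (s * z $ i) < 1" for i
      using mult_mono[of "cmod s" R "cmod (z $ i)" \<mu>] that \<mu>[of i] R\<mu> R1 by (auto simp: norm_mult)
    then have "s *s z \<in> polydisc" by (simp add: polydisc_def)
    then show ?thesis unfolding z(2) basic_map_scale[symmetric] by blast
  qed
  have hol: "(\<lambda>s. \<phi> (dilate m n s w)) holomorphic_on ball 0 R"
    by (rule mv_holomorphic_on_compose_curve[OF \<phi>(1) open_ball _ mem])
      (auto simp: dilate_def intro!: holomorphic_intros)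
  have "cmod (hom_part m n \<phi> k w) \<le> 1 / 1 ^ k" for k
    unfolding hom_part_def by (rule Taylor_coeff_bound[OF hol \<phi>(2)[OF mem]]) (use R1 in auto)
  moreover have "(\<lambda>k. hom_part m n \<phi> k w * s ^ k) sums \<phi> (dilate m n s w)" if "s \<in> ball 0 R" for s
    using holomorphic_power_series[OF hol that] by (simp add: hom_part_def)
  ultimately show thesis using that[OF R1 hol _ mem] by simp
qed

text \<open>For \<open>w\<close> of size \<open>R\<close> the dilates stay in a small ball about 0
  for all parameters up to a multiple of \<open>1 / (1 + R)\<close>, so the k-th component grows at
  most like \<open>(1 + R) ^ k\<close>. Once it is entire in each coordinate, Liouville's theorem
  makes it a polynomial of degree at most \<open>k\<close> in that coordinate.\<close>

lemma poly_fun_hom_part: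
  fixes \<phi> :: "complex^('d::{finite,linorder}) \<Rightarrow> complex"
  assumes mn: "m > 0" "n > 0" "n dvd m"
    and \<phi>: "mv_holomorphic_on \<phi> (basic_map m n ` polydisc)"
      "\<And>w. w \<in> basic_map m n ` polydisc \<Longrightarrow> cmod (\<phi> w) \<le> 1"
  shows "poly_fun (hom_part m n \<phi> k)"
proof -
  let ?\<Omega> = "basic_map m n ` (polydisc :: (complex^('d::{finite,linorder})) set)"
  let ?a = "hom_part m n \<phi>"
  obtain \<delta> where \<delta>: "\<delta> > 0" "ball 0 \<delta> \<subseteq> ?\<Omega>"
    using openE[OF open_basic_map_image[OF mn] zero_in_basic_map_image[OF mn(1,3)]] by blast
  \<comment> \<open>Division by the dimension bounds the norm by the coordinates; the cap at 1
    forces \<open>cmod s \<le> 1\<close> later, so that positive powers of \<open>s\<close> are no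
    larger than \<open>s\<close> itself.\<close>
  define \<epsilon> where "\<epsilon> = min 1 (\<delta> / CARD('d))"
  have \<epsilon>: "0 < \<epsilon>" "\<epsilon> \<le> 1" using \<delta> by (auto simp: \<epsilon>_def)
  have small: "w \<in> ?\<Omega>" if "\<And>i. cmod (w $ i) < \<epsilon>" for w
  proof -
    have "norm w \<le> (\<Sum>i\<in>UNIV. cmod (w $ i))" unfolding norm_vec_def by (rule L2_set_le_sum) auto
    also have "\<dots> < (\<Sum>i\<in>(UNIV::'d set). \<epsilon>)" by (rule sum_strict_mono) (use that in auto)
    also have "\<dots> \<le> \<delta>" using \<epsilon>_def by (simp add: min_def field_simps)
    finally show ?thesis using \<delta>(2) by auto
  qed
  define N where "N w = (\<Sum>i\<in>UNIV. cmod (w $ i))" for w :: "complex^('d::{finite,linorder})"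
  have N0: "N w \<ge> 0" and nth_le_N: "cmod (w $ i) \<le> N w" for w i
    unfolding N_def by (auto intro!: sum_nonneg member_le_sum)
  have N_upd: "N (vec_upd w i x) \<le> N w + cmod x" for w i x
  proof -
    have "N (vec_upd w i x) \<le> (\<Sum>j\<in>UNIV. cmod (w $ j) + (if j = i then cmod x else 0))"
      unfolding N_def by (intro sum_mono) auto
    then show ?thesis by (simp add: N_def sum.distrib)
  qed
  \<comment> \<open>Half of the admissible radius \<open>\<epsilon> / (1 + R)\<close>, leaving room
    for Cauchy's estimate on a closed disc.\<close>
  define S where "S R = \<epsilon> / (2 * (1 + R))" for R
  have S: "S R > 0" "S R < 1" if "R \<ge> 0" for R using \<epsilon> that by (auto simp: S_def field_simps)
  have mem: "dilate m n s w \<in> ?\<Omega>" if "cmod s < 2 * S R" "N w \<le> R" for s w R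
  proof (rule small)
    fix i :: 'd
    have R: "R \<ge> 0" using that(2) N0[of w] by linarith
    have "2 * S R = \<epsilon> / (1 + R)" using R by (simp add: S_def field_simps)
    then have s: "cmod s < \<epsilon> / (1 + R)" using that(1) by simp
    also have "\<dots> \<le> \<epsilon>" using R \<epsilon> by (simp add: field_simps)
    finally have s1: "cmod s \<le> 1" using \<epsilon> by linarith
    have "cmod s ^ weight m n i \<le> cmod s ^ 1"
      by (rule power_decreasing) (use s1 weight_pos[OF mn(1,3), of i] in auto)
    then have "cmod (dilate m n s w $ i) \<le> cmod s * R"
      using that(2) nth_le_N[of w i] by (auto simp: dilate_def norm_mult norm_power intro!: mult_mono)
    also have "\<dots> \<le> cmod s * (1 + R)" by (simp add: mult_left_mono)
    also have "\<dots> < \<epsilon>" using s R by (simp add: pos_less_divide_eq)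
    finally show "cmod (dilate m n s w $ i) < \<epsilon>" .
  qed
  have hol: "(\<lambda>s. \<phi> (dilate m n s w)) holomorphic_on ball 0 (2 * S R)" if "N w \<le> R" for w R
    by (rule mv_holomorphic_on_compose_curve[OF \<phi>(1) open_ball _ mem[OF _ that]])
      (auto simp: dilate_def intro!: holomorphic_intros)
  have coeff_bound: "cmod (?a k w) \<le> 1 / S R ^ k" if "N w \<le> R" for k w R
    unfolding hom_part_def
    by (rule Taylor_coeff_bound[OF hol[OF that] \<phi>(2)[OF mem[OF _ that]]]) (use S[of R] that N0[of w] in auto)
  have series: "(\<lambda>k. ?a k w * s ^ k) sums \<phi> (dilate m n s w)" if "N w \<le> R" "cmod s < 2 * S R" for w s R
    using holomorphic_power_series[OF hol[OF that(1)], of s] that(2) by (simp add: hom_part_def)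
  have entire: "(\<lambda>x. ?a k (vec_upd w i x)) holomorphic_on UNIV" for k w i
  proof (induction k rule: less_induct)
    case (less k)
    have "(\<lambda>x. ?a k (vec_upd w i x)) holomorphic_on ball 0 \<rho>" for \<rho>
    proof (cases "\<rho> > 0")
      case True
      define R where "R = N w + \<rho>"
      have NR: "N (vec_upd w i x) \<le> R" if "x \<in> ball 0 \<rho>" for x
        using N_upd[of w i x] that by (simp add: R_def)
      have R0: "R \<ge> 0" using N0[of w] True by (simp add: R_def)
      \<comment> \<open>Nonzero parameters tending to 0; the shift by 2 keeps the ratio to
        \<open>S R\<close> at most 1/2, so the geometric tail costs at most a factor 2.\<close>
      define s where "s j = complex_of_real (S R / (real j + 2))" for j :: nat
      have s_norm: "cmod (s j) = S R / (real j + 2)" for j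
        unfolding s_def norm_of_real using S(1)[OF R0] by simp
      have s_less2: "cmod (s j) < S R" for j
      proof -
        have "S R / (real j + 2) < S R / 1"
          by (rule divide_strict_left_mono) (use S(1)[OF R0] in auto)
        then show ?thesis by (simp add: s_norm)
      qed
      have s_less1: "cmod (s j) < 2 * S R" for j
        using s_less2[of j] S(1)[OF R0] by linarith
      have "cmod (s j) > 0" for j using S(1)[OF R0] by (simp add: s_norm)
      then have s_nz: "s j \<noteq> 0" for j by (metis norm_zero less_irrefl)
      \<comment> \<open>Removing the lower terms and dividing by \<open>s j ^ k\<close> isolates the
        k-th coefficient as \<open>s j\<close> tends to 0. The lower coefficients are entire by the
        induction hypothesis, so \<open>f j\<close> is holomorphic, and the limit is uniform on
        discs.\<close>
      define f where "f j x = (\<phi> (dilate m n (s j) (vec_upd w i x)) - (\<Sum>l<k. ?a l (vec_upd w i x) * s j ^ l)) / s j ^ k" for j x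
      have f_hol: "f j holomorphic_on ball 0 \<rho>" for j
      proof -
        have "(\<lambda>x. \<phi> (dilate m n (s j) (vec_upd w i x))) holomorphic_on ball 0 \<rho>"
        proof (rule mv_holomorphic_on_compose_curve[OF \<phi>(1) open_ball _ mem[OF s_less1 NR]])
          show "(\<lambda>x. dilate m n (s j) (vec_upd w i x) $ l) holomorphic_on ball 0 \<rho>" for l
            by (cases "l = i") (auto simp: dilate_def intro!: holomorphic_intros)
        qed
        moreover have "(\<lambda>x. ?a l (vec_upd w i x)) holomorphic_on ball 0 \<rho>" if "l < k" for l
          using less.IH[OF that] holomorphic_on_subset by blast
        ultimately show ?thesis unfolding f_def using s_nz by (intro holomorphic_intros) auto
      qed
      have err: "cmod (f j x - ?a k (vec_upd w i x)) \<le> 2 / (S R ^ k * (real j + 2))" if x: "x \<in> ball 0 \<rho>" for j x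
      proof -
        let ?v = "vec_upd w i x"
        let ?q = "cmod (s j) / S R"
        have q: "?q = 1 / (real j + 2)" using S(1)[OF R0] by (simp add: s_norm)
        have eq: "f j x - ?a k ?v = (\<phi> (dilate m n (s j) ?v) - (\<Sum>l<Suc k. ?a l ?v * s j ^ l)) / s j ^ k"
          using s_nz[of j] by (simp add: f_def field_simps)
        have tb: "cmod (\<phi> (dilate m n (s j) ?v) - (\<Sum>l<Suc k. ?a l ?v * s j ^ l)) \<le> ?q ^ Suc k / (1 - ?q)"
          by (rule power_series_tail_bound[OF series[OF NR[OF x] s_less1] coeff_bound[OF NR[OF x]] S(1)[OF R0] s_less2])
        have qb: "?q ^ Suc k / (1 - ?q) \<le> ?q ^ Suc k * 2"
        proof -
          have "1 / (1 - ?q) \<le> 2" unfolding q by (simp add: field_simps)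
          moreover have "?q ^ Suc k \<ge> 0" using S(1)[OF R0] by simp
          ultimately show ?thesis by (metis mult_left_mono times_divide_eq_right mult.right_neutral)
        qed
        have "cmod (f j x - ?a k ?v) \<le> ?q ^ Suc k * 2 / cmod (s j) ^ k"
          unfolding eq norm_divide norm_power by (rule divide_right_mono[OF order_trans[OF tb qb]]) simp
        also have "\<dots> = 2 / S R ^ k * ?q"
          using s_nz[of j] by (simp add: power_divide field_simps)
        also have "\<dots> = 2 / (S R ^ k * (real j + 2))" unfolding q by simp
        finally show ?thesis .
      qed
      have "uniform_limit (ball 0 \<rho>) f (\<lambda>x. ?a k (vec_upd w i x)) sequentially"
      proof (rule uniform_limitI)
        fix e :: real assume "e > 0"
        have "(\<lambda>j. 2 / (c * (real j + 2))) \<longlonglongrightarrow> 0" if "c > 0" for c :: real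
          using that by real_asymp
        then have "(\<lambda>j. 2 / (S R ^ k * (real j + 2))) \<longlonglongrightarrow> 0" using S(1)[OF R0] by simp
        then have "\<forall>\<^sub>F j in sequentially. 2 / (S R ^ k * (real j + 2)) < e"
          using \<open>e > 0\<close> by (rule order_tendstoD(2))
        then show "\<forall>\<^sub>F j in sequentially. \<forall>x\<in>ball 0 \<rho>. dist (f j x) (?a k (vec_upd w i x)) < e"
          by (rule eventually_mono) (unfold dist_norm, use err le_less_trans in blast)
      qed
      note ulim = this
      show ?thesis
      proof (rule holomorphic_uniform_sequence[where f = f, OF open_ball f_hol])
        fix x :: complex assume "x \<in> ball 0 \<rho>"
        then obtain d where "d > 0" "cball x d \<subseteq> ball 0 \<rho>"
          using open_contains_cball[THEN iffD1, OF open_ball] by meson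
        then show "\<exists>d. 0 < d \<and> cball x d \<subseteq> ball 0 \<rho> \<and>
            uniform_limit (cball x d) f (\<lambda>x. ?a k (vec_upd w i x)) sequentially"
          using uniform_limit_on_subset[OF ulim] by blast
      qed
    qed (simp add: not_less ball_empty holomorphic_on_def)
    then have "(\<lambda>x. ?a k (vec_upd w i x)) field_differentiable (at x)" for x
      using holomorphic_on_imp_differentiable_at[OF _ open_ball, of _ 0 "cmod x + 1" x] by simp
    then show ?case by (simp add: holomorphic_on_def field_differentiable_at_within)
  qed
  show ?thesis
  proof (rule poly_fun_if_separately_polynomial)
    fix w :: "complex^('d::{finite,linorder})" and i :: 'd
    \<comment> \<open>From \<open>1 + N w + cmod x \<le> (2 + N w) * cmod x\<close>, valid for
      \<open>cmod x \<ge> 1\<close>.\<close>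
    define B where "B = (2 * (2 + N w) / \<epsilon>) ^ k"
    have "?a k (vec_upd w i x) = (\<Sum>j\<le>k. (deriv ^^ j) (\<lambda>x. ?a k (vec_upd w i x)) 0 / fact j * x ^ j)" for x
    proof (rule Liouville_polynomial[OF entire, of 1 k w i B k])
      fix x :: complex assume x: "1 \<le> cmod x"
      let ?R = "N w + cmod x"
      have "cmod (?a k (vec_upd w i x)) \<le> 1 / S ?R ^ k" by (rule coeff_bound[OF N_upd])
      also have "\<dots> = (2 * (1 + ?R) / \<epsilon>) ^ k" by (simp add: S_def power_divide)
      also have "\<dots> \<le> (2 * (2 + N w) / \<epsilon> * cmod x) ^ k"
      proof (rule power_mono)
        have "N w * 1 \<le> N w * cmod x" using x N0[of w] by (intro mult_left_mono)
        then have "1 + ?R \<le> (2 + N w) * cmod x" using x by (simp add: algebra_simps)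
        then have "2 * (1 + ?R) / \<epsilon> \<le> 2 * ((2 + N w) * cmod x) / \<epsilon>" using \<epsilon> by (intro divide_right_mono) auto
        then show "2 * (1 + ?R) / \<epsilon> \<le> 2 * (2 + N w) / \<epsilon> * cmod x"
          by (simp only: mult.assoc times_divide_eq_left)
        show "0 \<le> 2 * (1 + ?R) / \<epsilon>" using N0[of w] \<epsilon> by simp
      qed
      also have "\<dots> = B * cmod x ^ k" unfolding B_def by (rule power_mult_distrib)
      finally show "cmod (?a k (vec_upd w i x)) \<le> B * cmod x ^ k" .
    qed
    then show "\<exists>c. \<forall>x. ?a k (vec_upd w i x) = (\<Sum>j\<le>k. c j * x ^ j)"
      by (intro exI[of _ "\<lambda>j. (deriv ^^ j) (\<lambda>x. ?a k (vec_upd w i x)) 0 / fact j"] allI)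
  qed
qed

text \<open>The bound 1 on the components makes their series converge uniformly on the image only
  after a dilation by some \<open>s < 1\<close>. So \<phi> is first dilated, then its series is
  truncated, and the result is rescaled to obtain a bound strictly below 1.\<close>

lemma Schur_approx_poly_fun:
  fixes \<phi> :: "complex^('d::{finite,linorder}) \<Rightarrow> complex"
  assumes mn: "m > 0" "n > 0" "n dvd m"
    and \<phi>: "mv_holomorphic_on \<phi> (basic_map m n ` polydisc)"
      "\<And>w. w \<in> basic_map m n ` polydisc \<Longrightarrow> cmod (\<phi> w) \<le> 1"
    and J: "finite J" "J \<subseteq> basic_map m n ` polydisc" and e: "e > 0"
  obtains p \<rho> where "poly_fun p" "\<rho> < 1" "\<And>w. w \<in> basic_map m n ` polydisc \<Longrightarrow> cmod (p w) \<le> \<rho>"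
    "\<And>w. w \<in> J \<Longrightarrow> cmod (p w - \<phi> w) < e"
proof -
  let ?\<Omega> = "basic_map m n ` (polydisc :: (complex^('d::{finite,linorder})) set)"
  \<comment> \<open>The error budget is \<open>2 * \<epsilon>\<close> for rescaling, \<epsilon> for
    truncation and \<epsilon> for dilation, in total less than \<open>e\<close>.\<close>
  define \<epsilon> where "\<epsilon> = e / 5"
  have \<epsilon>: "\<epsilon> > 0" using e by (simp add: \<epsilon>_def)
  define r :: "nat \<Rightarrow> real" where "r k = 1 - 1 / (real k + 2)" for k
  have r: "0 < r k" "r k < 1" for k by (auto simp: r_def field_simps)
  have r_lim: "r \<longlonglongrightarrow> 1" unfolding r_def by real_asymp
  have "\<forall>\<^sub>F k in sequentially. cmod (\<phi> (dilate m n (of_real (r k)) w) - \<phi> w) < \<epsilon>" if w: "w \<in> J" for w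
  proof -
    obtain R where R: "R > 1" "(\<lambda>s. \<phi> (dilate m n s w)) holomorphic_on ball 0 R"
      "\<And>k. cmod (hom_part m n \<phi> k w) \<le> 1"
      "\<And>s. s \<in> ball 0 R \<Longrightarrow> dilate m n s w \<in> ?\<Omega>"
      "\<And>s. s \<in> ball 0 R \<Longrightarrow> (\<lambda>k. hom_part m n \<phi> k w * s ^ k) sums \<phi> (dilate m n s w)"
      by (rule hom_part_in_image[OF \<phi> subsetD[OF J(2) w]]) (assumption, rule that)
    have "(\<lambda>k. complex_of_real (r k)) \<longlonglongrightarrow> of_real 1" by (intro tendsto_of_real r_lim)
    then have "(\<lambda>k. \<phi> (dilate m n (of_real (r k)) w)) \<longlonglongrightarrow> \<phi> (dilate m n (of_real 1) w)"
      by (rule continuous_on_tendsto_compose[OF holomorphic_on_imp_continuous_on[OF R(2)]])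
        (use R(1) r in \<open>auto intro!: always_eventually intro: less_trans simp: abs_of_pos\<close>)
    then show ?thesis using \<epsilon> by (auto simp: tendsto_iff dist_norm)
  qed
  then have "\<forall>\<^sub>F k in sequentially. \<forall>w\<in>J. cmod (\<phi> (dilate m n (of_real (r k)) w) - \<phi> w) < \<epsilon>"
    using J(1) by (intro eventually_ball_finite) auto
  then obtain k0 where k0: "\<And>w. w \<in> J \<Longrightarrow> cmod (\<phi> (dilate m n (of_real (r k0)) w) - \<phi> w) < \<epsilon>"
    unfolding eventually_sequentially by blast
  define s where "s = r k0"
  have s: "0 < s" "s < 1" using r by (auto simp: s_def)
  have "(\<lambda>K. s ^ K) \<longlonglongrightarrow> 0" using s by (intro LIMSEQ_realpow_zero) auto
  then have "(\<lambda>K. s ^ K / (1 - s)) \<longlonglongrightarrow> 0 / (1 - s)" by (intro tendsto_divide tendsto_const) (use s in auto)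
  then have "\<forall>\<^sub>F K in sequentially. s ^ K / (1 - s) < \<epsilon>" using \<epsilon> by (intro order_tendstoD(2)) auto
  then obtain K where K: "s ^ K / (1 - s) < \<epsilon>" unfolding eventually_sequentially by blast
  define P where "P w = (\<Sum>l<K. hom_part m n \<phi> l w * of_real s ^ l)" for w
  have P_poly: "poly_fun P" unfolding P_def[abs_def]
    by (intro poly_fun_intros poly_fun_hom_part[OF mn \<phi>])
  have P_err: "cmod (\<phi> (dilate m n (of_real s) w) - P w) < \<epsilon>" and P_bound: "cmod (P w) \<le> 1 + \<epsilon>" if w: "w \<in> ?\<Omega>" for w
  proof -
    obtain R where R: "R > 1" "(\<lambda>s. \<phi> (dilate m n s w)) holomorphic_on ball 0 R"
      "\<And>k. cmod (hom_part m n \<phi> k w) \<le> 1"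
      "\<And>s. s \<in> ball 0 R \<Longrightarrow> dilate m n s w \<in> ?\<Omega>"
      "\<And>s. s \<in> ball 0 R \<Longrightarrow> (\<lambda>k. hom_part m n \<phi> k w * s ^ k) sums \<phi> (dilate m n s w)"
      by (rule hom_part_in_image[OF \<phi> w]) (assumption, rule that)
    have sR: "complex_of_real s \<in> ball 0 R" using s R(1) by simp
    have "cmod (\<phi> (dilate m n (of_real s) w) - P w) \<le> (cmod (of_real s) / 1) ^ K / (1 - cmod (of_real s) / 1)"
      unfolding P_def by (rule power_series_tail_bound[OF R(5)[OF sR]]) (use R(3) s in auto)
    also have "\<dots> < \<epsilon>" using K s by simp
    finally show *: "cmod (\<phi> (dilate m n (of_real s) w) - P w) < \<epsilon>" .
    show "cmod (P w) \<le> 1 + \<epsilon>"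
      using * \<phi>(2)[OF R(4)[OF sR]] norm_triangle_ineq2[of "P w" "\<phi> (dilate m n (of_real s) w)"]
      by (simp add: norm_minus_commute)
  qed
  \<comment> \<open>Lowers the bound \<open>1 + \<epsilon>\<close> to its reciprocal, at the cost of
    an error \<open>(1 + \<epsilon>) - 1 / (1 + \<epsilon>) \<le> 2 * \<epsilon>\<close>.\<close>
  define c where "c = 1 / (1 + \<epsilon>) ^ 2"
  have c: "0 < c" "(1 + \<epsilon>) * c = 1 / (1 + \<epsilon>)" using \<epsilon> by (auto simp: c_def power2_eq_square)
  define p where "p w = of_real c * P w" for w
  have "poly_fun p" unfolding p_def[abs_def] by (intro poly_fun_intros P_poly)
  moreover have "1 / (1 + \<epsilon>) < 1" using \<epsilon> by simp
  moreover have "cmod (p w) \<le> 1 / (1 + \<epsilon>)" if "w \<in> ?\<Omega>" for w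
  proof -
    have "cmod (p w) = c * cmod (P w)" using c by (simp add: p_def norm_mult)
    also have "\<dots> \<le> c * (1 + \<epsilon>)" by (rule mult_left_mono[OF P_bound[OF that]]) (use c in simp)
    also have "\<dots> = 1 / (1 + \<epsilon>)" using c(2) by (simp add: mult.commute)
    finally show ?thesis .
  qed
  moreover have "cmod (p w - \<phi> w) < e" if "w \<in> J" for w
  proof -
    have w: "w \<in> ?\<Omega>" using J(2) that by auto
    have "1 \<le> (1 + \<epsilon>) ^ 2" using \<epsilon> by (intro one_le_power) simp
    then have c1: "c \<le> 1" unfolding c_def by (subst divide_le_eq_1_pos) (use \<epsilon> in auto)
    have "p w - P w = of_real (c - 1) * P w" by (simp add: p_def algebra_simps)
    then have "cmod (p w - P w) = (1 - c) * cmod (P w)" using c1 by (simp only: norm_mult norm_of_real) simp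
    also have "\<dots> \<le> (1 - c) * (1 + \<epsilon>)" using P_bound[OF w] c1 by (intro mult_left_mono) auto
    also have "\<dots> = (1 + \<epsilon>) - 1 / (1 + \<epsilon>)" using c(2) by (simp add: algebra_simps)
    also have "\<dots> \<le> 2 * \<epsilon>" using \<epsilon> by (simp add: field_simps)
    finally have "cmod (p w - P w) \<le> 2 * \<epsilon>" .
    moreover have "cmod (P w - \<phi> (dilate m n (of_real s) w)) < \<epsilon>"
      using P_err[OF w] by (simp add: norm_minus_commute)
    moreover have "cmod (\<phi> (dilate m n (of_real s) w) - \<phi> w) < \<epsilon>" using k0[OF that] by (simp add: s_def)
    moreover have "cmod (p w - \<phi> w) \<le> cmod (p w - P w) + cmod (P w - \<phi> (dilate m n (of_real s) w)) + cmod (\<phi> (dilate m n (of_real s) w) - \<phi> w)"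
      using norm_triangle_ineq[of "p w - P w" "P w - \<phi> (dilate m n (of_real s) w)"]
        norm_triangle_ineq[of "p w - \<phi> (dilate m n (of_real s) w)" "\<phi> (dilate m n (of_real s) w) - \<phi> w"] by simp
    ultimately show ?thesis using \<epsilon> by (simp add: \<epsilon>_def)
  qed
  ultimately show thesis using that by blast
qed

lemma Schur_norm_le_1:
  assumes "\<phi> \<in> Schur S" "z \<in> S"
  shows "cmod (\<phi> z) \<le> 1"
proof -
  have "bdd_above ((\<lambda>z. cmod (\<phi> z)) ` S)"
    using assms(1) by (auto simp: Schur_def Hinf_def bounded_iff intro: bdd_aboveI)
  then have "cmod (\<phi> z) \<le> sup_norm S \<phi>" unfolding sup_norm_def by (rule cSUP_upper[OF assms(2)])
  then show ?thesis using assms(1) by (simp add: Schur_def)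
qed

section \<open>Interpolation\<close>

theorem theorem4p3:
  fixes m n p :: nat
    and \<zeta> :: "nat \<Rightarrow> complex^('d::{finite,linorder})"
    and w :: "nat \<Rightarrow> complex"
  assumes "m > 0" and "n > 0" and "n dvd m"
    and "\<And>i. i \<in> {1..p} \<Longrightarrow> \<zeta> i \<in> basic_map m n ` polydisc"
    and "inj_on \<zeta> {1..p}"
    and "\<And>i. i \<in> {1..p} \<Longrightarrow> w i \<in> ball 0 1"
  shows "(\<exists>\<phi> \<in> Schur (basic_map m n ` polydisc). \<forall>i\<in>{1..p}. \<phi> (\<zeta> i) = w i) \<longleftrightarrow>
    (\<exists>f :: nat \<Rightarrow> complex^('d::{finite,linorder}) \<Rightarrow> complex. (\<forall>k. f k \<in> inner_on_image m n) \<and>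
       (\<forall>j\<in>{1..p}. (\<lambda>k. f k (\<zeta> j)) \<longlonglongrightarrow> w j))"
proof
  assume "\<exists>\<phi> \<in> Schur (basic_map m n ` polydisc). \<forall>i\<in>{1..p}. \<phi> (\<zeta> i) = w i"
  then obtain \<phi> where "\<phi> \<in> Schur (basic_map m n ` polydisc)" and \<phi>w: "\<And>i. i \<in> {1..p} \<Longrightarrow> \<phi> (\<zeta> i) = w i"
    by auto
  then have \<phi>: "mv_holomorphic_on \<phi> (basic_map m n ` polydisc)"
    "\<And>v. v \<in> basic_map m n ` polydisc \<Longrightarrow> cmod (\<phi> v) \<le> 1"
    using Schur_norm_le_1[of \<phi>] by (auto simp: Schur_def Hinf_def)
  have J: "finite (\<zeta> ` {1..p})" "\<zeta> ` {1..p} \<subseteq> basic_map m n ` polydisc" using assms(4) by auto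
  \<comment> \<open>Two approximations, of \<phi> by a polynomial and of that polynomial by an inner
    function, each cost less than \<open>1 / (k + 1)\<close> at all of the finitely many
    nodes.\<close>
  have "\<exists>g. g \<in> inner_on_image m n \<and> (\<forall>j\<in>{1..p}. cmod (g (\<zeta> j) - w j) < 2 / (real k + 1))" for k :: nat
  proof -
    define e where "e = 1 / (real k + 1)"
    have e: "e > 0" by (simp add: e_def)
    obtain q \<rho> where q: "poly_fun q" "\<rho> < 1" "\<And>v. v \<in> basic_map m n ` polydisc \<Longrightarrow> cmod (q v) \<le> \<rho>"
      "\<And>v. v \<in> \<zeta> ` {1..p} \<Longrightarrow> cmod (q v - \<phi> v) < e"
      using Schur_approx_poly_fun[OF assms(1-3) \<phi> J e] by metis
    obtain f where f: "\<And>k. f k \<in> inner_on_image m n"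
      "\<And>v. v \<in> basic_map m n ` polydisc \<Longrightarrow> (\<lambda>k. f k v) \<longlonglongrightarrow> q v"
      using inner_approx_poly_fun[OF assms(1-3) q(1,3,2)] by metis
    have "\<forall>\<^sub>F N in sequentially. cmod (f N v - q v) < e" if "v \<in> \<zeta> ` {1..p}" for v
      using f(2)[of v] that J(2) e by (auto simp: tendsto_iff dist_norm)
    then have "\<forall>\<^sub>F N in sequentially. \<forall>v\<in>\<zeta> ` {1..p}. cmod (f N v - q v) < e"
      using J(1) by (intro eventually_ball_finite) auto
    then obtain N where N: "\<And>v. v \<in> \<zeta> ` {1..p} \<Longrightarrow> cmod (f N v - q v) < e"
      unfolding eventually_sequentially by blast
    have "cmod (f N (\<zeta> j) - w j) < 2 / (real k + 1)" if j: "j \<in> {1..p}" for j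
    proof -
      have "cmod (f N (\<zeta> j) - w j) \<le> cmod (f N (\<zeta> j) - q (\<zeta> j)) + cmod (q (\<zeta> j) - \<phi> (\<zeta> j))"
        using norm_triangle_ineq[of "f N (\<zeta> j) - q (\<zeta> j)" "q (\<zeta> j) - \<phi> (\<zeta> j)"] \<phi>w[OF j] by simp
      also have "\<dots> < e + e" using N[of "\<zeta> j"] q(4)[of "\<zeta> j"] j by (intro add_strict_mono) auto
      finally show ?thesis by (simp add: e_def)
    qed
    then show ?thesis using f(1) by blast
  qed
  then have "\<exists>f. \<forall>k. f k \<in> inner_on_image m n \<and> (\<forall>j\<in>{1..p}. cmod (f k (\<zeta> j) - w j) < 2 / (real k + 1))"
    by (intro choice allI)
  then obtain f where "\<forall>k. f k \<in> inner_on_image m n \<and> (\<forall>j\<in>{1..p}. cmod (f k (\<zeta> j) - w j) < 2 / (real k + 1))" ..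
  then have f: "\<And>k. f k \<in> inner_on_image m n"
    "\<And>k j. j \<in> {1..p} \<Longrightarrow> cmod (f k (\<zeta> j) - w j) < 2 / (real k + 1)"
    by auto
  have "(\<lambda>k. f k (\<zeta> j)) \<longlonglongrightarrow> w j" if j: "j \<in> {1..p}" for j
  proof (rule LIM_zero_cancel, rule Lim_null_comparison)
    show "\<forall>\<^sub>F k in sequentially. norm (f k (\<zeta> j) - w j) \<le> 2 / (real k + 1)"
      using f(2)[OF j] by (intro always_eventually) (simp add: less_imp_le)
    show "(\<lambda>k. 2 / (real k + 1)) \<longlonglongrightarrow> 0" by real_asymp
  qed
  with f(1) show "\<exists>f. (\<forall>k. f k \<in> inner_on_image m n) \<and> (\<forall>j\<in>{1..p}. (\<lambda>k. f k (\<zeta> j)) \<longlonglongrightarrow> w j)"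
    by blast
next
  assume "\<exists>f :: nat \<Rightarrow> complex^('d::{finite,linorder}) \<Rightarrow> complex. (\<forall>k. f k \<in> inner_on_image m n) \<and>
    (\<forall>j\<in>{1..p}. (\<lambda>k. f k (\<zeta> j)) \<longlonglongrightarrow> w j)"
  then obtain f :: "nat \<Rightarrow> complex^('d::{finite,linorder}) \<Rightarrow> complex" where
    f: "\<And>k. f k \<in> inner_on_image m n" "\<And>j. j \<in> {1..p} \<Longrightarrow> (\<lambda>k. f k (\<zeta> j)) \<longlonglongrightarrow> w j"
    by blast
  let ?\<Omega> = "basic_map m n ` (polydisc :: (complex^('d::{finite,linorder})) set)"
  have hol: "mv_holomorphic_on (f k) ?\<Omega>" for k
    using f(1)[of k] by (simp add: inner_on_image_def Hinf_def)
  have bound: "cmod (f k v) \<le> 1" if "v \<in> ?\<Omega>" for k v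
  proof -
    obtain z where z: "z \<in> polydisc" "v = basic_map m n z" using \<open>v \<in> ?\<Omega>\<close> by blast
    have "inner_function (f k \<circ> basic_map m n)" using f(1)[of k] by (simp add: inner_on_image_def)
    from inner_function_norm_le_1[OF this z(1)] show ?thesis by (simp add: z(2))
  qed
  obtain \<phi> F where F: "F \<noteq> bot" "F \<le> sequentially" and \<phi>: "mv_holomorphic_on \<phi> ?\<Omega>"
    and lim: "\<And>v. v \<in> ?\<Omega> \<Longrightarrow> ((\<lambda>k. f k v) \<longlongrightarrow> \<phi> v) F"
    by (rule mv_Montel[OF open_basic_map_image[OF assms(1-3)] hol bound]) (assumption, rule that)
  have \<phi>1: "cmod (\<phi> v) \<le> 1" if "v \<in> ?\<Omega>" for v
    by (rule tendsto_upperbound[OF tendsto_norm[OF lim[OF that]] always_eventually F(1)]) (use bound[OF that] in blast)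
  \<comment> \<open>The image contains 0, so the real supremum in \<open>sup_norm\<close> runs over
    a nonempty set and is bounded by any pointwise bound.\<close>
  have "\<phi> \<in> Schur ?\<Omega>"
    unfolding Schur_def sup_norm_def Hinf_def bounded_iff
    using \<phi> \<phi>1 zero_in_basic_map_image[OF assms(1,3), where 'd='d] by (auto intro!: cSUP_least)
  \<comment> \<open>As \<open>F\<close> is finer than \<open>sequentially\<close>, the assumed
    limits at the nodes also hold along \<open>F\<close>.\<close>
  moreover have "\<phi> (\<zeta> j) = w j" if j: "j \<in> {1..p}" for j
    by (rule tendsto_unique[OF F(1) lim[OF assms(4)[OF j]] tendsto_mono[OF F(2) f(2)[OF j]]])
  ultimately show "\<exists>\<phi> \<in> Schur ?\<Omega>. \<forall>i\<in>{1..p}. \<phi> (\<zeta> i) = w i" by blast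
qed

end
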